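(* Let $n\ge 2$ be an integer, let $\varepsilon>0$, and let $s_1,s_2$ be real numbers with $s_1<1$, $s_2<1$ and $0<s_1+s_2\le 1$. For a point $\mathbf d=(d_1,d_2)\in\mathbb R^2$ there exist positive constants $c_0=c_0(n,\varepsilon,\mathbf d)$, $c_2=c_2(n,\varepsilon,\mathbf d)$ and $Q_0=Q_0(n,\varepsilon,\mathbf d,\mathbf s)$ such that the following holds. Let $Q>Q_0$ and let $\Pi=I_1\times I_2\subset\mathbb R^2$ be a rectangle with midpoint $\mathbf d$, where $I_1,I_2$ are intervals of lengths $\mu_1 I_i=c_{1,i}Q^{-s_i}$ ($c_{1,i}>0$, $i=1,2$), such that: 1. $\Pi\cap\{(x_1,x_2)\in\mathbb R^2:\ |x_1-x_2|<\varepsilon\}=\emptyset$; 2. if $s_1+s_2=1$, then $c_{1,1}c_{1,2}>c_0$. Then $$\#\mathcal A_n^2(Q,\Pi)\ge c_2\,Q^{n+1}\mu_2\Pi .$$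
   Context: For $Q>0$, $\mathcal P_n(Q)$ denotes the set of polynomials $P\in\mathbb Z[t]$ with $\deg P\le n$ and height $H(P)=\max_j|a_j|\le Q$, where $P(t)=a_nt^n+\dots+a_0$. A point $\boldsymbol\alpha=(\alpha_1,\alpha_2)\in\mathbb R^2$ is an algebraic point if $\alpha_1,\alpha_2$ are roots of a common polynomial in $\mathbb Z[t]$; its minimal polynomial is the polynomial $P\in\mathbb Z[t]$ of smallest degree with $P(\alpha_1)=P(\alpha_2)=0$ and coprime coefficients, and $\deg\boldsymbol\alpha=\deg P$, $H(\boldsymbol\alpha)=H(P)$. $\mathcal A_n^2(Q)$ is the set of algebraic points of degree at most $n$ and height at most $Q$, and $\mathcal A_n^2(Q,D)=\mathcal A_n^2(Q)\cap D$ for $D\subset\mathbb R^2$. $\mu_1,\mu_2$ denote Lebesgue measure on $\mathbb R$ and $\mathbb R^2$; $\#$ denotes cardinality.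
   Formalization: When s_1+s_2<1, Q_0 may also depend on c_{1,1}, c_{1,2}: with Q_0 independent of them the claim fails, since for fixed Q a tiny rectangle around a non-algebraic point d contains no point of A_n^2(Q). For s_1+s_2=1, Q_0 depends only on n, ε, d, s as stated. *)

theory Defs
  imports "HOL-Analysis.Analysis" "HOL-Computational_Algebra.Computational_Algebra"
begin

definition height :: "int poly \<Rightarrow> int" where
  "height P = Max ((\<lambda>j. \<bar>coeff P j\<bar>) ` {..degree P})"

definition vanishes_at :: "int poly \<Rightarrow> real \<times> real \<Rightarrow> bool" where
  "vanishes_at P \<alpha> \<longleftrightarrow>
     poly (map_poly of_int P) (fst \<alpha>) = 0 \<and> poly (map_poly of_int P) (snd \<alpha>) = 0"

definition algebraic_point :: "real \<times> real \<Rightarrow> bool" where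
  "algebraic_point \<alpha> \<longleftrightarrow> (\<exists>P. P \<noteq> 0 \<and> vanishes_at P \<alpha>)"

text \<open>The minimal polynomial of an algebraic point is determined only up to sign, which affects
  neither its degree nor its height. The condition \<open>content P = 1\<close> says that the coefficients
  are coprime and in particular excludes the zero polynomial.\<close>

definition min_poly :: "real \<times> real \<Rightarrow> int poly" where
  "min_poly \<alpha> = (SOME P. is_arg_min degree (\<lambda>P. Polynomial.content P = 1 \<and> vanishes_at P \<alpha>) P)"

definition point_degree :: "real \<times> real \<Rightarrow> nat" where
  "point_degree \<alpha> = degree (min_poly \<alpha>)"

definition point_height :: "real \<times> real \<Rightarrow> int" where
  "point_height \<alpha> = height (min_poly \<alpha>)"

definition algebraic_points :: "nat \<Rightarrow> real \<Rightarrow> (real \<times> real) set" where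
  "algebraic_points n Q =
     {\<alpha>. algebraic_point \<alpha> \<and> point_degree \<alpha> \<le> n \<and> of_int (point_height \<alpha>) \<le> Q}"

definition algebraic_points_in :: "nat \<Rightarrow> real \<Rightarrow> (real \<times> real) set \<Rightarrow> (real \<times> real) set" where
  "algebraic_points_in n Q D = algebraic_points n Q \<inter> D"

text \<open>Intervals may be open, closed or half-open.\<close>

definition interval_about :: "real \<Rightarrow> real \<Rightarrow> real set \<Rightarrow> bool" where
  "interval_about m l I \<longleftrightarrow>
     is_interval I \<and> bounded I \<and> I \<noteq> {} \<and> midpoint (Inf I) (Sup I) = m \<and> measure lborel I = l"

end

theory Submission
  imports Defs "HOL-Number_Theory.Cong"
begin

text \<open>
  Write \<open>d = (x, y)\<close> and let \<open>k, l\<close> be the side lengths. The separation hypothesis forces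
  \<open>k, l \<le> 2 |x - y|\<close>, so that only the inequality \<open>k l Q > c\<^sub>0\<close> matters. We count
  polynomials \<open>P = \<Sum> a\<^sub>j t\<^sup>j\<close> whose coefficients of index \<open>j \<ge> 2\<close> are positive and comparable to
  \<open>Q\<close>, with \<open>a\<^sub>2\<close> dominating the others so that \<open>P\<close> is strongly convex near \<open>x\<close> and \<open>y\<close>; then
  \<open>a\<^sub>1\<close> and \<open>a\<^sub>0\<close> range over intervals of lengths comparable to \<open>Q max(k, l)\<close> and
  \<open>Q min(k, l)\<close>, chosen such that \<open>|P(x)|\<close> and \<open>|P(y)|\<close> are small multiples of \<open>Q k\<close> and
  \<open>Q l\<close>. Strong convexity then yields roots within \<open>k / 2\<close> of \<open>x\<close> and within \<open>l / 2\<close> of \<open>y\<close>.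
  Congruence conditions on the coefficients make \<open>P\<close> satisfy Eisenstein's criterion at 2, and a sieve
  keeps a positive proportion with \<open>a\<^sub>n\<close> and \<open>a\<^sub>1\<close> coprime. Such \<open>P\<close> is primitive and
  irreducible, hence it is the minimal polynomial of its point, and distinct \<open>P\<close> give
  distinct points.
\<close>

section \<open>Minimal polynomials of algebraic points\<close>

lemma eval_of_int_poly_mult:
  "poly (map_poly of_int (p * q)) x = poly (map_poly of_int p) x * (poly (map_poly of_int q) x :: real)"
proof (induction p)
  case (pCons a p)
  have add: "map_poly of_int (u + v) = (map_poly of_int u + map_poly of_int v :: real poly)" for u v
    by (intro poly_eqI) (simp add: coeff_map_poly)
  have smult: "map_poly of_int (smult c u) = (smult (of_int c) (map_poly of_int u) :: real poly)" for c u
    by (intro poly_eqI) (simp add: coeff_map_poly)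
  show ?case
    using pCons by (simp add: add smult map_poly_pCons algebra_simps)
qed simp

lemma eval_of_int_poly_smult:
  "poly (map_poly of_int (smult c p)) x = of_int c * (poly (map_poly of_int p) x :: real)"
  using eval_of_int_poly_mult[of "[:c:]" p x] by (simp add: map_poly_pCons)

lemma eval_of_int_poly_add:
  "poly (map_poly of_int (p + q)) x = poly (map_poly of_int p) x + (poly (map_poly of_int q) x :: real)"
proof -
  have "map_poly of_int (p + q) = (map_poly of_int p + map_poly of_int q :: real poly)"
    by (intro poly_eqI) (simp add: coeff_map_poly)
  then show ?thesis by simp
qed

text \<open>As 4 does not divide the constant term, exactly one factor has an even constant term.
  The lowest odd coefficient of that factor produces an odd coefficient of \<open>P\<close> at the
  same index, which must then be the top one, so the other factor is constant. The content condition
  turns a constant factor into a unit.\<close>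

lemma eisenstein_at_2:
  fixes P :: "int poly"
  assumes content: "Polynomial.content P = 1" and deg: "degree P > 0"
    and odd: "odd (lead_coeff P)" and even: "\<And>i. i < degree P \<Longrightarrow> even (coeff P i)"
    and not4: "\<not> 4 dvd coeff P 0"
  shows "irreducible P"
proof -
  have main: "degree B = 0" if P: "P = A * B" and A0: "even (coeff A 0)" for A B
  proof (rule ccontr)
    assume B: "degree B \<noteq> 0"
    have "P \<noteq> 0" using deg by auto
    then have "A \<noteq> 0" "B \<noteq> 0" using P by auto
    then have degs: "degree P = degree A + degree B" unfolding P by (rule degree_mult_eq)
    have "odd (lead_coeff A)" using odd unfolding P lead_coeff_mult by simp
    define i where "i = (LEAST i. odd (coeff A i))"
    have i: "odd (coeff A i)"
      unfolding i_def by (rule LeastI[of "\<lambda>i. odd (coeff A i)", OF \<open>odd (lead_coeff A)\<close>])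
    have least: "\<And>j. j < i \<Longrightarrow> even (coeff A j)"
      using not_less_Least[of _ "\<lambda>i. odd (coeff A i)"] unfolding i_def by blast
    have "i \<le> degree A" using i by (metis coeff_eq_0 even_zero not_le)
    \<comment> \<open>The index \<open>i\<close> lies strictly below \<open>degree P\<close> because
      \<open>B\<close> is assumed non-constant.\<close>
    then have "even (coeff P i)" using even degs B by simp
    moreover have "coeff P i = coeff A i * coeff B 0 + (\<Sum>k<i. coeff A k * coeff B (i - k))"
    proof -
      have "{..i} = insert i {..<i}" by auto
      then show ?thesis unfolding P coeff_mult by simp
    qed
    moreover have "even (\<Sum>k<i. coeff A k * coeff B (i - k))"
      using least by (intro dvd_sum) auto
    moreover have "odd (coeff B 0)"
    proof
      assume "even (coeff B 0)"
      then have "2 * 2 dvd coeff A 0 * coeff B 0" using A0 by (intro mult_dvd_mono)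
      then show False using not4 P by (simp add: coeff_mult)
    qed
    ultimately show False using i by simp
  qed
  have unit: "A dvd 1" if P: "P = A * B" and "degree A = 0" for A B
  proof -
    obtain c where c: "A = [:c:]" using \<open>degree A = 0\<close> by (metis degree_eq_zeroE)
    have "Polynomial.content A dvd Polynomial.content P" using P by auto
    then have "is_unit c" using c content by simp
    then show ?thesis using c by (simp add: is_unit_poly_iff)
  qed
  show ?thesis
  proof (rule irreducibleI)
    show "P \<noteq> 0" using deg by auto
    show "\<not> P dvd 1" using deg by (auto simp: is_unit_poly_iff)
    fix A B assume P: "P = A * B"
    have "even (coeff A 0 * coeff B 0)"
      using even[of 0] deg P by (simp add: coeff_mult)
    then have "degree A = 0 \<or> degree B = 0"
      using main[of A B] main[of B A] P by (auto simp: mult.commute)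
    then show "A dvd 1 \<or> B dvd 1" using unit[of A B] unit[of B A] P by (auto simp: mult.commute)
  qed
qed

section \<open>Minimality of the minimal polynomial and its uniqueness up to sign\<close>

lemma vanishes_at_primitive_part:
  assumes "P \<noteq> 0" "vanishes_at P \<alpha>"
  shows "vanishes_at (primitive_part P) \<alpha>"
  using assms eval_of_int_poly_smult[of "Polynomial.content P" "primitive_part P"]
  unfolding vanishes_at_def by auto

text \<open>The choice in \<open>min_poly\<close> unfolds to \<open>arg_min\<close>, so one
  competitor makes it meaningful: the primitive part of any witness. Primitive parts keep the
  degree, which extends minimality to all nonzero polynomials vanishing at the point.\<close>

lemma min_poly_props:
  assumes "algebraic_point \<alpha>"
  shows "Polynomial.content (min_poly \<alpha>) = 1" "vanishes_at (min_poly \<alpha>) \<alpha>"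
    "\<And>P. P \<noteq> 0 \<Longrightarrow> vanishes_at P \<alpha> \<Longrightarrow> degree (min_poly \<alpha>) \<le> degree P"
proof -
  obtain P where P: "P \<noteq> 0" "vanishes_at P \<alpha>"
    using assms unfolding algebraic_point_def by auto
  have "Polynomial.content (primitive_part P) = 1 \<and> vanishes_at (primitive_part P) \<alpha>"
    using P vanishes_at_primitive_part by simp
  from is_arg_min_arg_min_nat[where P="\<lambda>P. Polynomial.content P = 1 \<and> vanishes_at P \<alpha>",
      of "primitive_part P" degree, OF this]
  have *: "is_arg_min degree (\<lambda>P. Polynomial.content P = 1 \<and> vanishes_at P \<alpha>) (min_poly \<alpha>)"
    unfolding arg_min_def min_poly_def .
  then show "Polynomial.content (min_poly \<alpha>) = 1" "vanishes_at (min_poly \<alpha>) \<alpha>"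
    by (auto simp: is_arg_min_linorder)
  show "degree (min_poly \<alpha>) \<le> degree P" if "P \<noteq> 0" "vanishes_at P \<alpha>" for P
  proof -
    have "degree (min_poly \<alpha>) \<le> degree (primitive_part P)"
      using * that vanishes_at_primitive_part[OF that] content_primitive_part[OF that(1)]
      unfolding is_arg_min_linorder by blast
    then show ?thesis using that by simp
  qed
qed

text \<open>Pseudo-division by the minimal polynomial \<open>R\<close> leaves a remainder that
  vanishes at the point, so minimality of the degree makes it zero. Gauss's lemma clears the
  multiplier, so \<open>R\<close> divides \<open>P\<close> over the integers, and irreducibility
  leaves a unit cofactor.\<close>

lemma min_poly_irreducible:
  assumes irr: "irreducible P" and cont: "Polynomial.content P = 1" and van: "vanishes_at P \<alpha>"
  shows "min_poly \<alpha> = P \<or> min_poly \<alpha> = - P"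
proof -
  define R where "R = min_poly \<alpha>"
  have alg: "algebraic_point \<alpha>"
    using van cont unfolding algebraic_point_def by (metis content_0 zero_neq_one)
  note R = min_poly_props[OF alg, folded R_def]
  have "R \<noteq> 0" using R(1) by auto
  obtain a q where a: "a \<noteq> 0" "smult a P = R * q + pseudo_mod P R"
    using pseudo_mod(1)[OF \<open>R \<noteq> 0\<close>, of P] by auto
  have "vanishes_at (pseudo_mod P R) \<alpha>"
    using van R(2) arg_cong[OF a(2), of "\<lambda>p. poly (map_poly of_int p) (fst \<alpha>) :: real"]
      arg_cong[OF a(2), of "\<lambda>p. poly (map_poly of_int p) (snd \<alpha>) :: real"]
    unfolding vanishes_at_def
    by (simp add: eval_of_int_poly_smult eval_of_int_poly_add eval_of_int_poly_mult)
  then have "pseudo_mod P R = 0"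
    using R(3) pseudo_mod(2)[OF \<open>R \<noteq> 0\<close>, of P] by (meson not_less)
  then have eq: "smult a P = R * q" using a by simp
  have "primitive_part (smult a P) = primitive_part R * primitive_part q"
    unfolding eq by (rule primitive_part_mult)
  then have "smult (unit_factor a) P = R * primitive_part q"
    using cont R(1) by (simp add: primitive_part_smult primitive_part_prim)
  \<comment> \<open>For integers \<open>unit_factor\<close> is the sign, its own inverse, and can be
    moved to the cofactor.\<close>
  moreover have "unit_factor a * unit_factor a = 1" using a(1) by (simp add: sgn_if)
  ultimately have "P = R * smult (unit_factor a) (primitive_part q)"
    by (metis mult_smult_right smult_1_left smult_smult)
  then obtain s where s: "P = R * s" ..
  have "\<not> is_unit R"
  proof
    assume "is_unit R"
    then obtain c where "R = [:c:]" "c dvd 1" by (auto simp: is_unit_poly_iff)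
    then show False using R(2) by (auto simp: vanishes_at_def map_poly_pCons)
  qed
  then have "is_unit s" using irreducibleD[OF irr s] by auto
  then obtain c where c: "s = [:c:]" "c dvd 1" by (auto simp: is_unit_poly_iff)
  then have "c = 1 \<or> c = -1" by (auto simp: zdvd1_eq)
  then show ?thesis using s c unfolding R_def by auto
qed

section \<open>Heights, and counting algebraic points by their polynomials\<close>

lemma height_uminus [simp]: "height (- P) = height P"
  by (simp add: height_def)

lemma coeff_le_height: "\<bar>coeff P i\<bar> \<le> height P"
proof (cases "i \<le> degree P")
  case True
  then show ?thesis unfolding height_def by (intro Max_ge) auto
next
  case False
  have "\<bar>coeff P 0\<bar> \<le> height P" unfolding height_def by (intro Max_ge) auto
  then show ?thesis using False by (simp add: coeff_eq_0)
qed

text \<open>Lower bounds on \<open>card\<close> need finiteness, since an infinite set has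
  \<open>card\<close> 0. Bounded degree and height leave finitely many minimal polynomials, each
  with finitely many pairs of roots.\<close>

lemma finite_algebraic_points: "finite (algebraic_points n Q)"
proof -
  define B where "B = Poly ` {xs. set xs \<subseteq> {-\<lfloor>Q\<rfloor>..\<lfloor>Q\<rfloor>} \<and> length xs \<le> n + 1}"
  define Z where "Z P = {x::real. poly (map_poly of_int P) x = 0}" for P :: "int poly"
  have "finite B" unfolding B_def by (intro finite_imageI finite_lists_length_le) auto
  have "finite (Z P)" if "P \<noteq> 0" for P
    unfolding Z_def using that by (intro poly_roots_finite) (simp add: map_poly_eq_0_iff)
  then have "finite (\<Union>P \<in> B - {0}. Z P \<times> Z P)" using \<open>finite B\<close> by auto
  moreover have "algebraic_points n Q \<subseteq> (\<Union>P \<in> B - {0}. Z P \<times> Z P)"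
  proof
    fix \<alpha> assume \<alpha>: "\<alpha> \<in> algebraic_points n Q"
    then have alg: "algebraic_point \<alpha>" and deg: "degree (min_poly \<alpha>) \<le> n"
      and h: "of_int (height (min_poly \<alpha>)) \<le> Q"
      by (auto simp: algebraic_points_def point_degree_def point_height_def)
    have "min_poly \<alpha> \<noteq> 0" using min_poly_props(1)[OF alg] by auto
    moreover have "min_poly \<alpha> \<in> B"
    proof -
      have "\<bar>c\<bar> \<le> \<lfloor>Q\<rfloor>" if "c \<in> set (coeffs (min_poly \<alpha>))" for c
      proof -
        have "c \<in> range (coeff (min_poly \<alpha>))" using that by (simp add: range_coeff)
        then have "\<bar>c\<bar> \<le> height (min_poly \<alpha>)" using coeff_le_height by auto
        also have "\<dots> \<le> \<lfloor>Q\<rfloor>" using h by linarith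
        finally show ?thesis .
      qed
      then have "set (coeffs (min_poly \<alpha>)) \<subseteq> {-\<lfloor>Q\<rfloor>..\<lfloor>Q\<rfloor>}" by (auto simp: abs_le_iff minus_le_iff)
      moreover have "length (coeffs (min_poly \<alpha>)) \<le> n + 1"
        using deg by (simp add: length_coeffs_degree \<open>min_poly \<alpha> \<noteq> 0\<close>)
      ultimately show ?thesis unfolding B_def by (intro image_eqI[of _ _ "coeffs (min_poly \<alpha>)"]) auto
    qed
    moreover have "\<alpha> \<in> Z (min_poly \<alpha>) \<times> Z (min_poly \<alpha>)"
      using min_poly_props(2)[OF alg] by (cases \<alpha>) (auto simp: Z_def vanishes_at_def)
    ultimately show "\<alpha> \<in> (\<Union>P \<in> B - {0}. Z P \<times> Z P)" by blast
  qed
  ultimately show ?thesis by (rule finite_subset[rotated])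
qed

text \<open>One point per polynomial is enough: its minimal polynomial gives the polynomial back up
  to sign, and the positive leading coefficient fixes the sign.\<close>

lemma card_algebraic_points_in_ge:
  fixes F :: "int poly set"
  assumes F: "\<And>P. P \<in> F \<Longrightarrow> irreducible P \<and> Polynomial.content P = 1 \<and> lead_coeff P > 0 \<and>
      degree P \<le> n \<and> of_int (height P) \<le> Q \<and> (\<exists>\<alpha>\<in>D. vanishes_at P \<alpha>)"
  shows "card F \<le> card (algebraic_points_in n Q D)"
proof -
  have "\<exists>r. \<forall>P\<in>F. r P \<in> D \<and> vanishes_at P (r P)"
    using F by (intro bchoice) blast
  then obtain r where r: "\<And>P. P \<in> F \<Longrightarrow> r P \<in> D" "\<And>P. P \<in> F \<Longrightarrow> vanishes_at P (r P)" by blast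
  have mp: "min_poly (r P) = P \<or> min_poly (r P) = - P" if "P \<in> F" for P
    using min_poly_irreducible F r that by blast
  have "inj_on r F"
  proof
    fix P P' assume *: "P \<in> F" "P' \<in> F" "r P = r P'"
    then have "P = P' \<or> P = - P'" using mp[of P] mp[of P'] by (metis minus_minus)
    moreover have "lead_coeff P > 0" "lead_coeff P' > 0" using F * by blast+
    ultimately show "P = P'" by (metis coeff_minus degree_minus neg_0_less_iff_less order_less_asym)
  qed
  moreover have "r ` F \<subseteq> algebraic_points_in n Q D"
  proof
    fix \<alpha> assume "\<alpha> \<in> r ` F"
    then obtain P where P: "P \<in> F" "\<alpha> = r P" by auto
    have "P \<noteq> 0" using F[OF P(1)] by auto
    then have "algebraic_point \<alpha>" using r P by (auto simp: algebraic_point_def)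
    moreover have "degree (min_poly \<alpha>) = degree P" "height (min_poly \<alpha>) = height P"
      using mp[OF P(1)] P(2) by auto
    ultimately show "\<alpha> \<in> algebraic_points_in n Q D"
      using F[OF P(1)] r[OF P(1)] P(2)
      by (auto simp: algebraic_points_in_def algebraic_points_def point_degree_def point_height_def)
  qed
  moreover have "finite (algebraic_points_in n Q D)"
    unfolding algebraic_points_in_def using finite_algebraic_points by auto
  ultimately show ?thesis using card_inj_on_le by blast
qed

section \<open>Rectangles and residue classes\<close>

text \<open>Membership of the endpoints is left open by \<open>interval_about\<close>, so only the
  open core is placed inside \<open>I\<close>. The two sets differ by at most two points, hence
  \<open>I\<close> is Borel, and its measure is squeezed between those of the open and the closed
  interval.\<close>

lemma interval_about_props:
  assumes "interval_about m l I" "l > 0"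
  shows "{m - l / 2<..<m + l / 2} \<subseteq> I" "I \<in> sets borel" "emeasure lborel I = ennreal l"
proof -
  define a b where "a = Inf I" "b = Sup I"
  have I: "is_interval I" "bounded I" "I \<noteq> {}" "(a + b) / 2 = m" "measure lborel I = l"
    using assms(1) by (auto simp: interval_about_def midpoint_def a_b_def)
  have bdd: "bdd_above I" "bdd_below I"
    using I(2) by (auto simp: bounded_imp_bdd_above bounded_imp_bdd_below)
  have sub: "I \<subseteq> {a..b}" using bdd by (auto simp: a_b_def cInf_lower cSup_upper)
  have sup: "{a<..<b} \<subseteq> I"
  proof
    fix x assume "x \<in> {a<..<b}"
    then obtain y z where "y \<in> I" "y < x" "z \<in> I" "x < z"
      using I(3) bdd by (auto simp: a_b_def cInf_less_iff less_cSup_iff)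
    then show "x \<in> I" using I(1) by (meson mem_is_interval_1_I less_imp_le)
  qed
  have "I = {a<..<b} \<union> (I \<inter> {a, b})" using sub sup by force
  moreover have "finite (I \<inter> {a, b})" by auto
  ultimately show borel: "I \<in> sets borel"
    by (metis borel_closed finite_imp_closed open_greaterThanLessThan borel_open sets.Un)
  have "a \<le> b" using sub I(3) by fastforce
  have "emeasure lborel I \<le> emeasure lborel {a..b}" using sub by (intro emeasure_mono) auto
  moreover have "emeasure lborel {a<..<b} \<le> emeasure lborel I" using sup borel by (intro emeasure_mono) auto
  ultimately have em: "emeasure lborel I = ennreal (b - a)" using \<open>a \<le> b\<close> by simp
  then have "l = b - a" using I(5) \<open>a \<le> b\<close> by (simp add: measure_def)
  then show "emeasure lborel I = ennreal l" using em by simp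
  have "m - l / 2 = a" "m + l / 2 = b" using I(4) \<open>l = b - a\<close> by (auto simp: field_simps)
  then show "{m - l / 2<..<m + l / 2} \<subseteq> I" using sup by simp
qed

lemma measure_interval_about_Times:
  assumes "interval_about m k I" "interval_about m' l J" "k > 0" "l > 0"
  shows "measure lborel (I \<times> J) = k * l"
proof -
  note I = interval_about_props[OF assms(1,3)] and J = interval_about_props[OF assms(2,4)]
  have "emeasure lborel (I \<times> J) = emeasure lborel I * emeasure lborel J"
    unfolding lborel_prod[symmetric] using I J by (intro lborel.emeasure_pair_measure_Times) auto
  also have "\<dots> = ennreal (k * l)" using I J assms by (simp add: ennreal_mult)
  finally show ?thesis using assms by (simp add: measure_def)
qed

text \<open>For a half-open window the admissible multiples of \<open>N\<close> are counted by a
  difference of floors, which loses less than 1 against \<open>l / N\<close> wherever the window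
  starts.\<close>

lemma card_residue_class_ge:
  fixes N r :: int and x l :: real
  assumes "N > 0"
  shows "finite {a::int. x < a \<and> a \<le> x + l \<and> [a = r] (mod N)}" (is "finite ?A")
    "l / N - 1 \<le> card {a::int. x < a \<and> a \<le> x + l \<and> [a = r] (mod N)}"
proof -
  have "?A \<subseteq> {\<lfloor>x\<rfloor>..\<lfloor>x + l\<rfloor>}" by (auto simp: le_floor_iff) linarith
  then show fin: "finite ?A" using finite_subset by blast
  define K where "K = {\<lfloor>(x - r) / N\<rfloor> + 1..\<lfloor>(x + l - r) / N\<rfloor>}"
  have "(\<lambda>k. r + N * k) ` K \<subseteq> ?A"
  proof safe
    fix k assume "k \<in> K"
    then have "(x - r) / N < k" "k \<le> (x + l - r) / N" by (auto simp: K_def) linarith+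
    then show "x < real_of_int (r + N * k)" "real_of_int (r + N * k) \<le> x + l"
      using assms by (auto simp: field_simps)
    show "[r + N * k = r] (mod N)" by (simp add: cong_def)
  qed
  then have "card K \<le> card ?A"
    using assms fin by (intro card_inj_on_le[of "\<lambda>k. r + N * k"]) (auto simp: inj_on_def)
  moreover have "l / N - 1 \<le> card K"
  proof -
    have "(x + l - r) / N = (x - r) / N + l / N" by (simp add: add_divide_distrib diff_divide_distrib)
    then have "l / N - 1 \<le> real_of_int (\<lfloor>(x + l - r) / N\<rfloor> - \<lfloor>(x - r) / N\<rfloor>)" by linarith
    then show ?thesis by (simp add: K_def) 
  qed
  ultimately show "l / N - 1 \<le> card ?A" by linarith
qed

text \<open>The upper bound for the sieve: integers in one class modulo \<open>M\<close> that are
  divisible by some \<open>k\<close> coprime to \<open>M\<close> differ by multiples of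
  \<open>k * M\<close>. The least element serves as origin, so no common residue has to be
  computed.\<close>

lemma card_spaced_le:
  fixes A :: "int set" and N :: int and x l :: real
  assumes "N > 0" "l \<ge> 0" and A: "\<And>a. a \<in> A \<Longrightarrow> x < a \<and> a \<le> x + l"
    and spaced: "\<And>a b. a \<in> A \<Longrightarrow> b \<in> A \<Longrightarrow> N dvd a - b"
  shows "finite A" "card A \<le> l / N + 1"
proof -
  have "A \<subseteq> {\<lfloor>x\<rfloor>..\<lfloor>x + l\<rfloor>}" using A by (fastforce simp: le_floor_iff floor_le_iff)
  then show fin: "finite A" using finite_subset by blast
  show "card A \<le> l / N + 1"
  proof (cases "A = {}")
    case False
    define m where "m = Min A"
    have m: "m \<in> A" "\<And>a. a \<in> A \<Longrightarrow> m \<le> a" using fin False by (auto simp: m_def)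
    have "(\<lambda>a. (a - m) div N) ` A \<subseteq> {0..\<lfloor>l / N\<rfloor>}"
    proof safe
      fix a assume a: "a \<in> A"
      then obtain k where k: "a - m = N * k" using spaced[OF _ m(1)] by (metis dvdE)
      then have "real_of_int a - m = N * k" by (metis of_int_diff of_int_mult)
      moreover have "real_of_int a - m \<le> l" using A[OF a] A[OF m(1)] by linarith
      ultimately have "k \<le> l / N" using assms(1) by (simp add: field_simps)
      moreover have "0 \<le> k" using k m(2)[OF a] assms(1) by (smt (verit) zero_le_mult_iff)
      ultimately show "(a - m) div N \<in> {0..\<lfloor>l / N\<rfloor>}" using k assms(1) by (simp add: le_floor_iff)
    qed
    moreover have "inj_on (\<lambda>a. (a - m) div N) A"
    proof
      fix a b assume *: "a \<in> A" "b \<in> A" "(a - m) div N = (b - m) div N"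
      then have "N dvd a - m" "N dvd b - m" using spaced m by auto
      then show "a = b" using *(3) by (metis diff_add_cancel dvd_div_mult_self)
    qed
    ultimately have "card A \<le> card {0..\<lfloor>l / N\<rfloor>}" by (intro card_inj_on_le) auto
    then have "real (card A) \<le> real (card {0..\<lfloor>l / N\<rfloor>})" by simp
    also have "\<dots> = \<lfloor>l / N\<rfloor> + 1" using assms by simp
    also have "\<dots> \<le> l / N + 1" by simp
    finally show ?thesis .
  qed (use assms in auto)
qed

section \<open>Coprime pairs\<close>

text \<open>Telescoping: \<open>1 / k^2\<close> is at most
  \<open>1 / (k - 1) - 1 / k\<close>.\<close>

lemma sum_inverse_squares_le:
  assumes "m > 0"
  shows "(\<Sum>k\<in>{m<..N}. 1 / (real k)\<^sup>2) \<le> 1 / real m"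
proof (cases "m \<le> N")
  case True
  then have "(\<Sum>k\<in>{m<..N}. 1 / (real k)\<^sup>2) \<le> 1 / real m - 1 / real N"
  proof (induction N rule: dec_induct)
    case (step N)
    have "{m<..Suc N} = insert (Suc N) {m<..N}" using step by auto
    moreover have "1 / (real (Suc N))\<^sup>2 \<le> 1 / real N - 1 / real (Suc N)"
    proof -
      have "1 / (real (Suc N))\<^sup>2 \<le> 1 / (real N * real (Suc N))"
        using step assms by (intro divide_left_mono) (auto simp: power2_eq_square)
      also have "\<dots> = 1 / real N - 1 / real (Suc N)"
        using step assms by (simp add: field_simps)
      finally show ?thesis .
    qed
    ultimately show ?case using step by simp
  qed auto
  also have "\<dots> \<le> 1 / real m" by simp
  finally show ?thesis .
qed auto

text \<open>Each term is at most twice an increment of the square root. This is weaker than a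
  logarithm, but small enough against the window lengths of the sieve.\<close>

lemma sum_inverses_le: "(\<Sum>k\<in>{1..N}. 1 / real k) \<le> 2 * sqrt (real N)"
proof (induction N)
  case (Suc N)
  define x y where "x = sqrt (real N)" and "y = sqrt (real (Suc N))"
  have xy: "0 \<le> x" "1 \<le> y" "x \<le> y" "y\<^sup>2 = x\<^sup>2 + 1" "y\<^sup>2 = real (Suc N)" by (auto simp: x_def y_def)
  have "1 = (y - x) * (y + x)" using xy by (simp add: algebra_simps power2_eq_square)
  also have "\<dots> \<le> (y - x) * (2 * y\<^sup>2)"
  proof (intro mult_left_mono)
    have "y * 1 \<le> y * y" using xy by (intro mult_left_mono) auto
    then show "y + x \<le> 2 * y\<^sup>2" using xy(3) unfolding power2_eq_square by linarith
  qed (use xy in auto)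
  finally have "1 / y\<^sup>2 \<le> 2 * (y - x)" using xy by (simp add: field_simps)
  then have "1 / real (Suc N) \<le> 2 * (y - x)" by (simp only: xy(5))
  then show ?case using Suc by (simp add: x_def y_def)
qed simp

text \<open>Count all pairs, then subtract those with a common divisor \<open>c > 1\<close>. As
  \<open>a\<close> is 1 modulo \<open>M\<close>, such \<open>c\<close> is coprime to
  \<open>M\<close>, hence exceeds 32, and it divides at most
  \<open>(L / (c * m) + 1) * (l / (c * m) + 1)\<close> pairs. Summed over \<open>c\<close> this is
  at most half of the guaranteed total. The window of \<open>b\<close> may be as short as a multiple
  of \<open>sqrt L\<close> and may move with \<open>a\<close>.\<close>

lemma card_coprime_pairs_ge:
  fixes M :: int and L l :: real and v :: "int \<Rightarrow> real"
  assumes M: "M > 0" "\<And>c. 1 < c \<Longrightarrow> c \<le> 32 \<Longrightarrow> c dvd M"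
    and L: "L > 0" "sqrt L \<ge> 96 * real_of_int M" "l \<ge> 96 * real_of_int M * sqrt L"
  defines "A \<equiv> {a::int. L < a \<and> a \<le> L + L \<and> [a = 1] (mod M)}"
    and "B \<equiv> \<lambda>a. {b::int. v a < b \<and> b \<le> v a + l \<and> [b = 0] (mod M)}"
  shows "L * l / (8 * (real_of_int M)\<^sup>2) \<le> card {(a, b). a \<in> A \<and> b \<in> B a \<and> coprime a b}" (is "_ \<le> real (card ?G)")
proof -
  define m where "m = real_of_int M"
  note L = L[folded m_def]
  define u where "u = sqrt L"
  have u: "L = u\<^sup>2" "u \<ge> 96 * m" "l \<ge> 96 * m * u" using L by (auto simp: u_def)
  have m1: "1 \<le> m" using M(1) unfolding m_def by linarith
  have "96 * m * (96 * m) \<le> 96 * m * u" using u m1 by (intro mult_left_mono) auto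
  then have l2: "l \<ge> 9216 * m\<^sup>2" using u by (simp add: power2_eq_square)
  have "u * 1 \<le> u * u" using u m1 by (intro mult_left_mono) auto
  have "m * 1 \<le> m * m" using m1 by (intro mult_left_mono) auto
  with \<open>u * 1 \<le> u * u\<close> have pos: "l > 0" "u > 0" "L \<ge> 2 * m" "l \<ge> 2 * m"
    using m1 u l2 unfolding power2_eq_square by linarith+
  have resA: "finite A" "L / m - 1 \<le> card A"
    unfolding A_def m_def using card_residue_class_ge[OF M(1)] by blast+
  have resB: "finite (B a)" "l / m - 1 \<le> card (B a)" for a
    unfolding B_def m_def using card_residue_class_ge[OF M(1)] by blast+
  define S where "S = Sigma A B"
  have finS: "finite S" using resA resB by (auto simp: S_def)
  have half: "x / (2 * m) \<le> x / m - 1" if "x \<ge> 2 * m" for x :: real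
    using that m1 by (simp add: field_simps)
  \<comment> \<open>Both windows have length at least \<open>2 * m\<close>, so absorbing the error 1
    costs a factor 2 each.\<close>
  have "L * l / (4 * m\<^sup>2) = (L / (2 * m)) * (l / (2 * m))" by (simp add: power2_eq_square)
  also have "\<dots> \<le> card A * (l / (2 * m))"
    using half[OF pos(3)] resA(2) pos m1 by (intro mult_right_mono) auto
  also have "\<dots> = (\<Sum>a\<in>A. l / (2 * m))" by simp
  also have "\<dots> \<le> (\<Sum>a\<in>A. real (card (B a)))"
    using half[OF pos(4)] resB(2) by (intro sum_mono) (meson order_trans)
  also have "\<dots> = card S" unfolding S_def using resA resB by (subst card_SigmaI) auto
  finally have total: "L * l / (4 * m\<^sup>2) \<le> card S" .
  \<comment> \<open>A common divisor divides the positive number \<open>a\<close>, which is at most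
    \<open>2 * L\<close>; this caps the sieve even if \<open>b\<close> is 0.\<close>
  define N where "N = nat \<lfloor>2 * L\<rfloor>"
  define T where "T k = (SIGMA a:{a \<in> A. int k dvd a}. {b \<in> B a. int k dvd b})" for k
  define C where "C = {k \<in> {32<..N}. coprime (int k) M}"
  have bad: "S - ?G \<subseteq> (\<Union>k\<in>C. T k)"
  proof
    fix z assume z: "z \<in> S - ?G"
    obtain a b where ab: "z = (a, b)" "a \<in> A" "b \<in> B a" "\<not> coprime a b"
      using z by (auto simp: S_def)
    define c where "c = gcd a b"
    have a: "L < a" "a \<le> 2 * L" "[a = 1] (mod M)" using ab by (auto simp: A_def)
    have "a > 0" using a L by linarith
    have "c > 0" using \<open>a > 0\<close> by (simp add: c_def)
    moreover have "c \<noteq> 1" using ab by (simp add: c_def coprime_iff_gcd_eq_1)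
    ultimately have "c > 1" by simp
    have "coprime a M" using a(3) by (metis cong_imp_coprime coprime_1_left cong_sym)
    then have cop: "coprime c M" unfolding c_def by (meson coprime_divisors dvd_refl gcd_dvd1)
    have "c > 32"
    proof (rule ccontr)
      assume "\<not> c > 32"
      then have "c dvd M" using M(2) \<open>c > 1\<close> by simp
      then have "is_unit c" using cop by (meson coprime_common_divisor dvd_refl)
      then show False using \<open>c > 1\<close> by simp
    qed
    have "c \<le> a" using \<open>a > 0\<close> unfolding c_def by (simp add: zdvd_imp_le)
    then have "c \<le> \<lfloor>2 * L\<rfloor>" using a by linarith
    then have "nat c \<in> C" using \<open>c > 32\<close> cop by (auto simp: C_def N_def)
    moreover have "z \<in> T (nat c)" using ab \<open>c > 32\<close> by (auto simp: T_def c_def)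
    ultimately show "z \<in> (\<Union>k\<in>C. T k)" by blast
  qed
  have cardT: "finite (T k) \<and> card (T k) \<le> (L / (k * m) + 1) * (l / (k * m) + 1)" if "k \<in> C" for k
  proof -
    have k: "k > 0" "coprime (int k) M" using that by (auto simp: C_def)
    have kM: "int k * M > 0" using k M by simp
    have km: "real k * m = real_of_int (int k * M)" by (simp add: m_def)
    have spaced: "int k * M dvd a - b"
      if "int k dvd a" "int k dvd b" "[a = r] (mod M)" "[b = r] (mod M)" for a b r
    proof -
      have "M dvd a - b" using that by (metis cong_iff_dvd_diff cong_sym cong_trans)
      then show ?thesis using k that by (intro divides_mult) auto
    qed
    have 1: "finite {a \<in> A. int k dvd a}" "card {a \<in> A. int k dvd a} \<le> L / (k * m) + 1"
      unfolding km
      by (rule card_spaced_le[OF kM, where x=L and l=L];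
          use L(1) spaced in \<open>auto simp: A_def\<close>)+
    have 2: "finite {b \<in> B a. int k dvd b}" "card {b \<in> B a. int k dvd b} \<le> l / (k * m) + 1" for a
      unfolding km
      by (rule card_spaced_le[OF kM, where x="v a" and l=l];
          use pos(1) spaced in \<open>auto simp: B_def\<close>)+
    have "real (card (T k)) = (\<Sum>a\<in>{a \<in> A. int k dvd a}. real (card {b \<in> B a. int k dvd b}))"
      unfolding T_def using 1 2 by (subst card_SigmaI) auto
    also have "\<dots> \<le> (\<Sum>a\<in>{a \<in> A. int k dvd a}. l / (k * m) + 1)"
      using 2 by (intro sum_mono) auto
    also have "\<dots> = card {a \<in> A. int k dvd a} * (l / (k * m) + 1)" by simp
    also have "\<dots> \<le> (L / (k * m) + 1) * (l / (k * m) + 1)"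
      using 1 pos m1 by (intro mult_right_mono) auto
    finally show ?thesis using 1 2 by (auto simp: T_def)
  qed
  have finC: "finite C" by (simp add: C_def)
  have "card (S - ?G) \<le> card (\<Union>k\<in>C. T k)" using bad finC cardT by (intro card_mono) auto
  also have "\<dots> \<le> (\<Sum>k\<in>C. card (T k))" using finC by (rule card_UN_le)
  finally have "real (card (S - ?G)) \<le> (\<Sum>k\<in>C. real (card (T k)))"
    unfolding of_nat_sum[symmetric] by (simp only: of_nat_le_iff)
  also have "\<dots> \<le> (\<Sum>k\<in>C. (L / (k * m) + 1) * (l / (k * m) + 1))"
    using cardT by (intro sum_mono) auto
  also have "\<dots> \<le> (\<Sum>k\<in>{32<..N}. (L / (k * m) + 1) * (l / (k * m) + 1))"
    using pos L m1 by (intro sum_mono2) (auto simp: C_def)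
  also have "\<dots> = (\<Sum>k\<in>{32<..N}. L * l / m\<^sup>2 * (1 / (real k)\<^sup>2) + (L + l) / m * (1 / real k) + 1)"
  proof (intro sum.cong refl)
    fix k assume "k \<in> {32<..N}"
    then have "real k > 0" by auto
    then show "(L / (k * m) + 1) * (l / (k * m) + 1)
        = L * l / m\<^sup>2 * (1 / (real k)\<^sup>2) + (L + l) / m * (1 / real k) + 1"
      using m1 by (simp add: field_simps power2_eq_square)
  qed
  also have "\<dots> = L * l / m\<^sup>2 * (\<Sum>k\<in>{32<..N}. 1 / (real k)\<^sup>2)
      + (L + l) / m * (\<Sum>k\<in>{32<..N}. 1 / real k) + real (card {32<..N})"
    by (simp only: sum.distrib sum_distrib_left[symmetric]) simp
  \<comment> \<open>Beyond 32 the inverse squares sum to at most 1/32 and the inverses to at most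
    \<open>3 * sqrt L\<close>, and there are at most \<open>2 * L\<close> terms.\<close>
  also have "\<dots> \<le> L * l / m\<^sup>2 * (1 / 32) + (L + l) / m * (3 * u) + 2 * L"
  proof (intro add_mono mult_left_mono)
    show "(\<Sum>k\<in>{32<..N}. 1 / (real k)\<^sup>2) \<le> 1 / 32" using sum_inverse_squares_le[of 32 N] by simp
    have NL: "real N \<le> 2 * L" using L by (simp add: N_def)
    have "(\<Sum>k\<in>{32<..N}. 1 / real k) \<le> (\<Sum>k\<in>{1..N}. 1 / real k)" by (intro sum_mono2) auto
    also have "\<dots> \<le> 2 * sqrt (real N)" by (rule sum_inverses_le)
    also have "\<dots> \<le> 2 * sqrt (2 * L)" using NL by simp
    also have "\<dots> \<le> 2 * sqrt ((3 / 2 * u)\<^sup>2)" using L u by (intro mult_left_mono real_sqrt_le_mono) (auto simp: power2_eq_square)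
    also have "\<dots> = 3 * u" using pos by simp
    finally show "(\<Sum>k\<in>{32<..N}. 1 / real k) \<le> 3 * u" .
    show "real (card {32<..N}) \<le> 2 * L" using NL by simp
  qed (use pos L m1 in auto)
  also have "\<dots> \<le> L * l / (8 * m\<^sup>2)"
  proof -
    have "3 * u * L * m * 32 \<le> L * l"
      using mult_left_mono[OF u(3), of L] L(1) by (simp add: algebra_simps)
    moreover have "3 * u * l * m * 32 \<le> L * l"
    proof -
      have "(l * u) * (96 * m) \<le> (l * u) * u" using u(2) pos by (intro mult_left_mono) auto
      then show ?thesis by (simp add: u(1) power2_eq_square algebra_simps)
    qed
    moreover have "2 * L * m\<^sup>2 * 32 \<le> L * l"
    proof -
      have "L * (64 * m\<^sup>2) \<le> L * l" using l2 L zero_le_power2[of m] by (intro mult_left_mono) linarith+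
      then show ?thesis by (simp add: algebra_simps)
    qed
    \<comment> \<open>After scaling by \<open>32 * m^2\<close> each of the four terms is at most
      \<open>L * l\<close>. The 96 = 3 * 32 in the hypotheses is what the two cross terms
      require.\<close>
    ultimately have le: "L * l + 3 * u * L * m * 32 + 3 * u * l * m * 32 + 2 * L * m\<^sup>2 * 32 \<le> 4 * (L * l)"
      by linarith
    have "L * l / m\<^sup>2 * (1 / 32) + (L + l) / m * (3 * u) + 2 * L
        = (L * l + 3 * u * L * m * 32 + 3 * u * l * m * 32 + 2 * L * m\<^sup>2 * 32) / (32 * m\<^sup>2)"
      using m1 by (simp add: field_simps power2_eq_square)
    also have "\<dots> \<le> 4 * (L * l) / (32 * m\<^sup>2)" by (intro divide_right_mono le) simp
    finally show ?thesis by simp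
  qed
  finally have "real (card (S - ?G)) \<le> L * l / (8 * m\<^sup>2)" .
  moreover have "card S = card (S - ?G) + card ?G"
  proof -
    have "?G \<subseteq> S" by (auto simp: S_def)
    then show ?thesis using finS
      by (metis (no_types, lifting) add.commute card_Diff_subset card_mono finite_subset le_add_diff_inverse)
  qed
  moreover have "L * l / (4 * m\<^sup>2) = L * l / (8 * m\<^sup>2) + L * l / (8 * m\<^sup>2)" by simp
  ultimately show ?thesis using total unfolding m_def[symmetric] by linarith
qed

section \<open>Roots of strongly convex polynomials\<close>

text \<open>Strong convexity alone, with no control of the derivatives, forces a sign change close to a
  point where the function is small.\<close>

lemma strongly_convex_root_near:
  fixes f :: "real \<Rightarrow> real"
  assumes conv: "convex_on S (\<lambda>x. f x - m * x\<^sup>2)" and cont: "continuous_on UNIV f"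
    and s: "0 < s" "s \<le> 1 / 2"
    and S: "x \<in> S" "y \<in> S" "x - s * (y - x) \<in> S"
    and small: "2 * \<bar>f x\<bar> + s * \<bar>f y\<bar> < m * s * (y - x)\<^sup>2 / 2" and "m \<ge> 0"
  shows "\<exists>z. \<bar>z - x\<bar> \<le> s * \<bar>y - x\<bar> \<and> f z = 0"
proof -
  define g where "g = (\<lambda>x. f x - m * x\<^sup>2)"
  define h where "h t = f (x + t * (y - x))" for t
  have sy: "s * \<bar>f y\<bar> \<ge> 0" using s by simp
  have sfy: "s * f y \<le> s * \<bar>f y\<bar>" "- (s * f y) \<le> s * \<bar>f y\<bar>"
    using s mult_left_mono[of "f y" "\<bar>f y\<bar>" s] mult_left_mono[of "- f y" "\<bar>f y\<bar>" s] by auto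
  have quart: "m * s * (y - x)\<^sup>2 / 2 \<le> m * s * (1 - s) * (y - x)\<^sup>2"
  proof -
    have "(m * s * (y - x)\<^sup>2) * (1 / 2) \<le> (m * s * (y - x)\<^sup>2) * (1 - s)"
      using s \<open>m \<ge> 0\<close> by (intro mult_left_mono) auto
    then show ?thesis by (simp add: algebra_simps)
  qed
  \<comment> \<open>Strong convexity puts the graph below the chord from \<open>x\<close> to
    \<open>y\<close> by at least \<open>m * s * (1 - s) * (y - x)^2\<close>, which outweighs the end
    values.\<close>
  have "g ((1 - s) * x + s * y) \<le> (1 - s) * g x + s * g y"
    using convex_onD[OF conv[folded g_def], of s x y] s S by simp
  moreover have "(1 - s) * x + s * y = x + s * (y - x)" by (simp add: algebra_simps)
  ultimately have "h s \<le> (1 - s) * f x + s * f y - m * s * (1 - s) * (y - x)\<^sup>2"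
    unfolding g_def h_def by (simp add: algebra_simps power2_eq_square)
  moreover have "(1 - s) * f x \<le> \<bar>f x\<bar>"
  proof -
    have "(1 - s) * f x \<le> (1 - s) * \<bar>f x\<bar>" using s by (intro mult_left_mono) auto
    also have "\<dots> \<le> 1 * \<bar>f x\<bar>" using s by (intro mult_right_mono) auto
    finally show ?thesis by simp
  qed
  ultimately have neg: "h s \<le> 0" using small sfy quart by linarith
  \<comment> \<open>This weight makes \<open>x\<close> a convex combination of
    \<open>x - s * (y - x)\<close> and \<open>y\<close>; the deficit at \<open>x\<close> then forces
    a nonnegative value on the far side of \<open>x\<close>.\<close>
  define t where "t = s / (1 + s)"
  have t: "0 \<le> t" "t \<le> 1" "(1 + s) * t = s" "(1 + s) * (1 - t) = 1"
    using s by (auto simp: t_def field_simps)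
  have xe: "(1 - t) * (x - s * (y - x)) + t * y = x"
  proof -
    have "(1 + s) * ((1 - t) * (x - s * (y - x)) + t * y) = (1 + s) * x"
      unfolding distrib_left mult.assoc[symmetric] t(3,4) by (simp add: algebra_simps)
    then show ?thesis using s by simp
  qed
  have "g x \<le> (1 - t) * g (x - s * (y - x)) + t * g y"
    using convex_onD[OF conv[folded g_def], of t "x - s * (y - x)" y] t S xe by simp
  then have "(1 + s) * g x \<le> (1 + s) * ((1 - t) * g (x - s * (y - x)) + t * g y)"
    using s by (intro mult_left_mono) auto
  also have "\<dots> = g (x - s * (y - x)) + s * g y"
    unfolding distrib_left mult.assoc[symmetric] t(3,4) by simp
  finally have "h (- s) \<ge> (1 + s) * f x - s * f y + m * s * (1 + s) * (y - x)\<^sup>2"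
    unfolding g_def h_def by (simp add: algebra_simps power2_eq_square)
  moreover have "(1 + s) * f x \<ge> - (2 * \<bar>f x\<bar>)"
  proof -
    have "(1 + s) * (- f x) \<le> (1 + s) * \<bar>f x\<bar>" using s by (intro mult_left_mono) auto
    also have "\<dots> \<le> 2 * \<bar>f x\<bar>" using s by (intro mult_right_mono) auto
    finally show ?thesis by simp
  qed
  moreover have "m * s * (1 - s) * (y - x)\<^sup>2 \<le> m * s * (1 + s) * (y - x)\<^sup>2"
    using s \<open>m \<ge> 0\<close> by (intro mult_left_mono mult_right_mono) auto
  ultimately have pos: "h (- s) \<ge> 0" using small sfy quart by linarith
  have "continuous_on {- s..s} h"
    unfolding h_def by (intro continuous_on_compose2[OF cont] continuous_intros) auto
  then obtain r where "- s \<le> r" "r \<le> s" "h r = 0"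
    using IVT2'[of h s 0 "- s"] neg pos s by auto
  then show ?thesis
    by (intro exI[of _ "x + r * (y - x)"]) (auto simp: h_def abs_mult intro!: mult_right_mono)
qed

text \<open>The second derivative of the sum is \<open>2 * a 2\<close> plus at most \<open>n\<close>
  terms, each bounded by \<open>n^2 * R^n * \<eta>\<close>; \<open>R \<ge> 1\<close> permits the
  uniform power. Subtracting \<open>2 * m\<close> leaves it nonnegative.\<close>

lemma polynomial_strongly_convex:
  fixes a :: "nat \<Rightarrow> real"
  assumes "n \<ge> 2" "R \<ge> 1" "\<eta> \<ge> 0" and a: "\<And>j. 3 \<le> j \<Longrightarrow> j \<le> n \<Longrightarrow> \<bar>a j\<bar> \<le> \<eta>"
    and m: "2 * m + real n ^ 3 * R ^ n * \<eta> \<le> 2 * a 2"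
  shows "convex_on {-R..R} (\<lambda>x. (\<Sum>j\<le>n. a j * x ^ j) - m * x\<^sup>2)"
proof (rule f''_ge0_imp_convex)
  fix x assume x: "x \<in> {-R..R}"
  show "((\<lambda>x. (\<Sum>j\<le>n. a j * x ^ j) - m * x\<^sup>2) has_real_derivative
      ((\<Sum>j\<le>n. a j * (real j * x ^ (j - 1))) - 2 * m * x)) (at x)"
    by (auto intro!: derivative_eq_intros sum.cong)
  show "((\<lambda>x. (\<Sum>j\<le>n. a j * (real j * x ^ (j - 1))) - 2 * m * x) has_real_derivative
      ((\<Sum>j\<le>n. a j * (real j * (real (j - 1) * x ^ (j - 2)))) - 2 * m)) (at x)"
    by (auto intro!: derivative_eq_intros sum.cong simp: numeral_2_eq_2)
  have "{..n} = {0, 1, 2} \<union> {3..n}" using \<open>n \<ge> 2\<close> by auto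
  then have "(\<Sum>j\<le>n. a j * (real j * (real (j - 1) * x ^ (j - 2))))
      = 2 * a 2 + (\<Sum>j=3..n. a j * (real j * (real (j - 1) * x ^ (j - 2))))"
    by (subst \<open>{..n} = _\<close>, subst sum.union_disjoint) auto
  moreover have "\<bar>\<Sum>j=3..n. a j * (real j * (real (j - 1) * x ^ (j - 2)))\<bar> \<le> real n ^ 3 * R ^ n * \<eta>"
  proof -
    have "\<bar>\<Sum>j=3..n. a j * (real j * (real (j - 1) * x ^ (j - 2)))\<bar>
        \<le> (\<Sum>j=3..n. \<bar>a j * (real j * (real (j - 1) * x ^ (j - 2)))\<bar>)" by (rule sum_abs)
    also have "\<dots> \<le> (\<Sum>j=3..n. \<eta> * (real n * (real n * R ^ n)))"
    proof (intro sum_mono)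
      fix j assume j: "j \<in> {3..n}"
      have "\<bar>x\<bar> ^ (j - 2) \<le> R ^ (j - 2)" using x by (intro power_mono) auto
      also have "\<dots> \<le> R ^ n" using j \<open>R \<ge> 1\<close> by (intro power_increasing) auto
      finally show "\<bar>a j * (real j * (real (j - 1) * x ^ (j - 2)))\<bar> \<le> \<eta> * (real n * (real n * R ^ n))"
        unfolding abs_mult using j a \<open>\<eta> \<ge> 0\<close> by (intro mult_mono) (auto simp: power_abs)
    qed
    also have "\<dots> = real (n - 2) * (\<eta> * (real n * (real n * R ^ n)))" by simp
    also have "\<dots> \<le> real n * (\<eta> * (real n * (real n * R ^ n)))"
      using assms by (intro mult_right_mono) auto
    also have "\<dots> = real n ^ 3 * R ^ n * \<eta>" by (simp add: power3_eq_cube)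
    finally show ?thesis .
  qed
  ultimately show "(\<Sum>j\<le>n. a j * (real j * (real (j - 1) * x ^ (j - 2)))) - 2 * m \<ge> 0"
    using m by linarith
qed (rule convex_real_interval)

section \<open>Families of Eisenstein polynomials\<close>

definition coeff_poly :: "nat \<Rightarrow> (nat \<Rightarrow> int) \<Rightarrow> int poly" where
  "coeff_poly n a = (\<Sum>j\<le>n. monom (a j) j)"

lemma coeff_coeff_poly: "coeff (coeff_poly n a) j = (if j \<le> n then a j else 0)"
  by (simp add: coeff_poly_def coeff_sum)

lemma degree_coeff_poly: "a n \<noteq> 0 \<Longrightarrow> degree (coeff_poly n a) = n"
  by (intro antisym le_degree degree_le) (auto simp: coeff_coeff_poly)

lemma eval_coeff_poly:
  "poly (map_poly of_int (coeff_poly n a)) x = (\<Sum>j\<le>n. of_int (a j) * (x::real) ^ j)"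
proof -
  have "map_poly of_int (coeff_poly n a) = (\<Sum>j\<le>n. monom (of_int (a j) :: real) j)"
    by (intro poly_eqI) (simp add: coeff_map_poly coeff_coeff_poly coeff_sum)
  then show ?thesis by (simp add: poly_sum poly_monom)
qed

text \<open>Eisenstein at 2 only needs the residues modulo 4. Primitivity comes from two coprime
  coefficients, so a sieve on a single pair suffices.\<close>

lemma coeff_poly_irreducible:
  fixes a :: "nat \<Rightarrow> int" and M :: int
  assumes "n \<ge> 2" "4 dvd M" "[a n = 1] (mod M)" "[a 0 = 2] (mod M)"
    and mid: "\<And>j. 0 < j \<Longrightarrow> j < n \<Longrightarrow> [a j = 0] (mod M)"
    and cop: "coprime (a n) (a 1)"
  shows "irreducible (coeff_poly n a)" "Polynomial.content (coeff_poly n a) = 1"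
proof -
  let ?P = "coeff_poly n a"
  have mod4: "a j mod 4 = r mod 4" if "[a j = r] (mod M)" for j r
    using cong_dvd_modulus[OF that assms(2)] by (simp add: cong_def)
  have odd: "odd (a n)" using mod4[OF assms(3)] by presburger
  have a0: "a 0 mod 4 = 2" using mod4[OF assms(4)] by simp
  have even: "even (a j)" if "j < n" for j
  proof (cases "j = 0")
    case True
    then show ?thesis using a0 by simp presburger
  next
    case False
    then have "a j mod 4 = 0" using mod4[OF mid] that by simp
    then show ?thesis by presburger
  qed
  have deg: "degree ?P = n" using odd by (intro degree_coeff_poly) auto
  show content: "Polynomial.content ?P = 1"
  proof -
    have "Polynomial.content ?P dvd a n" "Polynomial.content ?P dvd a 1"
      using content_dvd_coeff[of ?P n] content_dvd_coeff[of ?P 1] \<open>n \<ge> 2\<close>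
      by (simp_all add: coeff_coeff_poly)
    then have "is_unit (Polynomial.content ?P)" using cop by (meson coprime_common_divisor)
    then show ?thesis by (simp only: is_unit_content_iff)
  qed
  show "irreducible ?P"
  proof (rule eisenstein_at_2[OF content])
    show "\<not> 4 dvd coeff ?P 0" using a0 by (simp add: coeff_coeff_poly dvd_eq_mod_eq_0)
  qed (use deg odd even \<open>n \<ge> 2\<close> in \<open>auto simp: coeff_coeff_poly\<close>)
qed

text \<open>The coefficients are chosen in stages, each range depending on earlier choices; lower
  bounds uniform in those choices multiply. Extensionality makes \<open>f\<close> recoverable from
  the coefficients of index 2 to \<open>n - 1\<close>.\<close>

lemma card_coeff_poly_family_ge:
  fixes X :: "(nat \<Rightarrow> int) set" and Y :: "(nat \<Rightarrow> int) \<Rightarrow> (int \<times> int) set"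
    and Z :: "(nat \<Rightarrow> int) \<Rightarrow> int \<times> int \<Rightarrow> int set" and p z :: real
  assumes "n \<ge> 2" and X: "X \<subseteq> extensional {2..<n}" "finite X"
    and Y: "\<And>f. f \<in> X \<Longrightarrow> finite (Y f) \<and> p \<le> card (Y f)"
    and Z: "\<And>f q. f \<in> X \<Longrightarrow> q \<in> Y f \<Longrightarrow> finite (Z f q) \<and> z \<le> card (Z f q)"
    and "z \<ge> 0"
  defines "F \<equiv> {coeff_poly n (f(n := b, 1 := c, 0 := d)) | f b c d. f \<in> X \<and> (b, c) \<in> Y f \<and> d \<in> Z f (b, c)}"
  shows "card X * (p * z) \<le> card F"
proof -
  define S where "S = (SIGMA f:X. Sigma (Y f) (Z f))"
  define \<phi> where "\<phi> = (\<lambda>(f, (b, c), d). coeff_poly n (f(n := b, 1 := c, 0 := d)))"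
  have F: "F = \<phi> ` S" 
  proof
    show "F \<subseteq> \<phi> ` S"
    proof
      fix P assume "P \<in> F"
      then obtain f b c d where "P = coeff_poly n (f(n := b, 1 := c, 0 := d))"
        "f \<in> X" "(b, c) \<in> Y f" "d \<in> Z f (b, c)"
        unfolding F_def by blast
      then show "P \<in> \<phi> ` S"
        by (intro image_eqI[of _ _ "(f, (b, c), d)"]) (auto simp: S_def \<phi>_def)
    qed
    show "\<phi> ` S \<subseteq> F" unfolding F_def S_def \<phi>_def by auto
  qed
  have "inj_on \<phi> S"
  proof
    fix s s' assume s: "s \<in> S" "s' \<in> S" "\<phi> s = \<phi> s'"
    obtain f b c d where f: "s = (f, (b, c), d)" by (metis surj_pair)
    obtain f' b' c' d' where f': "s' = (f', (b', c'), d')" by (metis surj_pair)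
    have eq: "(f(n := b, 1 := c, 0 := d)) j = (f'(n := b', 1 := c', 0 := d')) j" if "j \<le> n" for j
      using arg_cong[OF s(3), of "\<lambda>P. coeff P j"] that by (simp add: \<phi>_def f f' coeff_coeff_poly)
    have "b = b'" "c = c'" "d = d'" using eq[of n] eq[of 1] eq[of 0] \<open>n \<ge> 2\<close> by auto
    moreover have "f = f'"
    proof (rule extensionalityI)
      show "f \<in> extensional {2..<n}" "f' \<in> extensional {2..<n}" using s f f' X by (auto simp: S_def)
      show "f j = f' j" if "j \<in> {2..<n}" for j using eq[of j] that by auto
    qed
    ultimately show "s = s'" using f f' by simp
  qed
  then have "card F = card S" unfolding F by (rule card_image)
  also have "\<dots> = (\<Sum>f\<in>X. \<Sum>q\<in>Y f. card (Z f q))"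
    unfolding S_def using X Y Z by (subst card_SigmaI) auto
  finally have "real (card F) = (\<Sum>f\<in>X. \<Sum>q\<in>Y f. real (card (Z f q)))" by simp
  moreover have "p * z \<le> (\<Sum>q\<in>Y f. real (card (Z f q)))" if "f \<in> X" for f
  proof -
    have "p * z \<le> card (Y f) * z" using Y[OF that] \<open>z \<ge> 0\<close> by (intro mult_right_mono) auto
    also have "\<dots> = (\<Sum>q\<in>Y f. z)" by simp
    also have "\<dots> \<le> (\<Sum>q\<in>Y f. real (card (Z f q)))" using Z that by (intro sum_mono) auto
    finally show ?thesis .
  qed
  then have "(\<Sum>f\<in>X. p * z) \<le> (\<Sum>f\<in>X. \<Sum>q\<in>Y f. real (card (Z f q)))" by (rule sum_mono)
  ultimately show ?thesis by simp
qed

section \<open>Polynomials with roots near two distinct real points\<close>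

locale two_points =
  fixes n :: nat and x y :: real
  assumes n2: "n \<ge> 2" and xy: "x \<noteq> y"
begin

text \<open>The coefficient \<open>a\<^sub>j\<close>, \<open>j \<ge> 2\<close>, ranges over \<open>(lam j Q, 2 lam j Q]\<close>. The choice of
  \<open>\<delta>\<close> keeps the height below \<open>Q\<close>, that of \<open>\<delta>'\<close> makes \<open>P'' \<ge> \<delta> Q\<close> on \<open>[-R, R]\<close>, and
  \<open>\<kappa> Q k\<close>, \<open>\<kappa> Q l\<close> are the bounds imposed on \<open>|P(x)|\<close>, \<open>|P(y)|\<close>.\<close>

definition "\<Delta> = \<bar>y - x\<bar>"
definition "R = 1 + 2 * \<bar>x\<bar> + 2 * \<bar>y\<bar>"
definition "W a t = (\<Sum>j=2..n. real_of_int (a j) * t ^ j)"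
definition "E = 2 * real n * R ^ n"
definition "\<delta> = 1 / (2 + \<Delta>\<^sup>2 + R * (2 * E / \<Delta> + \<Delta>) + E)"
definition "\<delta>' = \<delta> / (2 * real n ^ 3 * R ^ n)"
definition "lam j = (if j = 2 then \<delta> else \<delta>')" for j :: nat
definition "\<kappa> = \<delta> * \<Delta> / 48"

lemma pos: "\<Delta> > 0" "R \<ge> 1" "E > 0" "\<delta> > 0" "\<delta>' > 0" "\<kappa> > 0" "lam j > 0"
proof -
  show D: "\<Delta> > 0" using xy by (simp add: \<Delta>_def)
  show R: "R \<ge> 1" by (simp add: R_def)
  then show E: "E > 0" using n2 by (simp add: E_def)
  have "R * (2 * E / \<Delta> + \<Delta>) > 0" using D R E by (intro mult_pos_pos add_pos_pos) auto
  then show d: "\<delta> > 0" unfolding \<delta>_def using E by (intro divide_pos_pos add_pos_pos) (auto intro: add_pos_nonneg)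
  then show d': "\<delta>' > 0" unfolding \<delta>'_def using R n2 by simp
  show "\<kappa> > 0" using d D by (simp add: \<kappa>_def)
  show "lam j > 0" using d d' by (simp add: lam_def)
qed

text \<open>The three factors of \<open>\<delta>\<close> will bound
  \<open>\<bar>a j\<bar> / (\<delta> * Q)\<close> for \<open>j \<ge> 2\<close>, \<open>j = 1\<close>
  and \<open>j = 0\<close> respectively; the denominator of \<open>\<delta>\<close> dominates each
  of them.\<close>

lemma \<delta>_bounds: "\<delta> * 2 \<le> 1" "\<delta> * (2 * E / \<Delta> + \<Delta>) \<le> 1"
  "\<delta> * (\<Delta>\<^sup>2 + R * (2 * E / \<Delta> + \<Delta>) + E) \<le> 1"
proof -
  define u where "u = 2 * E / \<Delta> + \<Delta>"
  have u: "u > 0" using pos unfolding u_def by (intro add_pos_pos divide_pos_pos) auto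
  have "1 * u \<le> R * u" using u pos by (intro mult_right_mono) auto
  have d: "\<delta> = 1 / (2 + \<Delta>\<^sup>2 + R * u + E)" by (simp add: \<delta>_def u_def)
  have le: "\<delta> * t \<le> 1" if "t \<le> 2 + \<Delta>\<^sup>2 + R * u + E" for t
  proof -
    have "0 < 2 + \<Delta>\<^sup>2 + R * u + E" using u pos by (intro add_pos_pos mult_pos_pos) (auto intro: add_pos_nonneg)
    then show ?thesis using that by (simp add: d)
  qed
  have "0 \<le> \<Delta>\<^sup>2" by simp
  then show "\<delta> * 2 \<le> 1" "\<delta> * (2 * E / \<Delta> + \<Delta>) \<le> 1" "\<delta> * (\<Delta>\<^sup>2 + R * (2 * E / \<Delta> + \<Delta>) + E) \<le> 1"
    unfolding u_def[symmetric] using u pos(3) \<open>1 * u \<le> R * u\<close> by (intro le; linarith)+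
qed

lemma lam_le: "\<delta>' \<le> lam j" "lam j \<le> \<delta>"
proof -
  have "1 \<le> real n ^ 3" "1 \<le> R ^ n" using n2 pos by (auto intro: one_le_power)
  then have "1 * 1 \<le> real n ^ 3 * R ^ n" by (intro mult_mono) auto
  then have "1 \<le> 2 * real n ^ 3 * R ^ n" by simp
  moreover have "\<delta> / K \<le> \<delta>" if "1 \<le> K" for K
    using that pos(4) mult_left_mono[of 1 K \<delta>] by (simp add: divide_le_eq)
  ultimately have "\<delta>' \<le> \<delta>" unfolding \<delta>'_def by blast
  then show "\<delta>' \<le> lam j" "lam j \<le> \<delta>" by (auto simp: lam_def)
qed

lemma sum_split: "(\<Sum>j\<le>n. real_of_int (a j) * t ^ j) = a 0 + a 1 * t + W a t"
proof -
  have "{..n} = {0, 1} \<union> {2..n}" using n2 by auto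
  then show ?thesis unfolding W_def by (subst \<open>{..n} = _\<close>, subst sum.union_disjoint) auto
qed

text \<open>Strong convexity with modulus \<open>\<delta> * Q / 2\<close> is used at either point,
  with the other as far end. The step \<open>s = k / (4 * \<Delta>)\<close> gives a root within
  \<open>k / 4\<close>, hence strictly within \<open>k / 2\<close>, and
  \<open>k \<le> 2 * \<Delta>\<close> gives \<open>s \<le> 1 / 2\<close>.\<close>

lemma root_near:
  fixes a :: "nat \<Rightarrow> int"
  assumes a: "\<And>j. 2 \<le> j \<Longrightarrow> j \<le> n \<Longrightarrow> lam j * Q < a j \<and> a j \<le> 2 * lam j * Q" and "Q > 0"
    and pts: "(u, v) = (x, y) \<or> (u, v) = (y, x)"
    and k: "0 < k" "k \<le> 2 * \<Delta>" "0 < l" "l \<le> 2 * \<Delta>"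
  defines "p \<equiv> \<lambda>t. \<Sum>j\<le>n. real_of_int (a j) * t ^ j"
  assumes small: "\<bar>p u\<bar> \<le> \<kappa> * Q * k" "\<bar>p v\<bar> \<le> \<kappa> * Q * l"
  shows "\<exists>z. \<bar>z - u\<bar> < k / 2 \<and> p z = 0"
proof -
  define s where "s = k / (4 * \<Delta>)"
  have uv: "\<bar>v - u\<bar> = \<Delta>" "(v - u)\<^sup>2 = \<Delta>\<^sup>2" using pts by (auto simp: \<Delta>_def power2_commute)
  have s: "0 < s" "s \<le> 1 / 2" "k = 4 * \<Delta> * s" using k pos by (auto simp: s_def field_simps)
  have conv: "convex_on {-R..R} (\<lambda>t. p t - \<delta> * Q / 2 * t\<^sup>2)"
    unfolding p_def
  proof (rule polynomial_strongly_convex[OF n2, where \<eta> = "2 * \<delta>' * Q"])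
    \<comment> \<open>The definition of \<open>\<delta>'\<close> aims at this equality: half of the
      lower bound \<open>2 * \<delta> * Q\<close> for \<open>2 * a 2\<close> absorbs the higher
      coefficients, the other half is the convexity.\<close>
    have "real n ^ 3 * R ^ n * (2 * \<delta>' * Q) = \<delta> * Q"
      using n2 pos by (simp add: \<delta>'_def)
    moreover have "\<delta> * Q < a 2" using a[of 2] n2 by (simp add: lam_def)
    ultimately show "2 * (\<delta> * Q / 2) + real n ^ 3 * R ^ n * (2 * \<delta>' * Q) \<le> 2 * real_of_int (a 2)"
      by linarith
    show "\<bar>real_of_int (a j)\<bar> \<le> 2 * \<delta>' * Q" if "3 \<le> j" "j \<le> n" for j
    proof -
      have "lam j * Q > 0" using pos \<open>Q > 0\<close> by simp
      moreover have "lam j = \<delta>'" using that by (simp add: lam_def)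
      ultimately show ?thesis using a[of j] that by auto
    qed
  qed (use pos \<open>Q > 0\<close> in auto)
  have "\<exists>z. \<bar>z - u\<bar> \<le> s * \<bar>v - u\<bar> \<and> p z = 0"
  proof (rule strongly_convex_root_near[OF conv _ s(1,2), where y = v])
    show "continuous_on UNIV p" unfolding p_def by (intro continuous_intros)
    show "u \<in> {-R..R}" "v \<in> {-R..R}" using pts by (auto simp: R_def)
    \<comment> \<open>\<open>R\<close> leaves room for an overshoot of at most
      \<open>\<Delta> / 2\<close> past \<open>u\<close>.\<close>
    have "\<bar>s * (v - u)\<bar> \<le> \<Delta> / 2" using s pos uv mult_right_mono[of s "1/2" \<Delta>] by (simp add: abs_mult)
    moreover have "\<Delta> \<le> \<bar>x\<bar> + \<bar>y\<bar>" by (simp add: \<Delta>_def)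
    moreover have "\<bar>u\<bar> \<le> \<bar>x\<bar> + \<bar>y\<bar>" using pts by auto
    ultimately show "u - s * (v - u) \<in> {-R..R}" unfolding R_def atLeastAtMost_iff by linarith
    have "s * \<bar>p v\<bar> \<le> s * (\<kappa> * Q * (2 * \<Delta>))"
    proof (intro mult_left_mono)
      have "\<kappa> * Q * l \<le> \<kappa> * Q * (2 * \<Delta>)" using k pos \<open>Q > 0\<close> by (intro mult_left_mono) auto
      then show "\<bar>p v\<bar> \<le> \<kappa> * Q * (2 * \<Delta>)" using small by linarith
    qed (use s in auto)
    \<comment> \<open>The two terms contribute 8 and 2; the 48 in \<open>\<kappa>\<close> keeps
      10/48 below the required 1/4.\<close>
    then have "2 * \<bar>p u\<bar> + s * \<bar>p v\<bar> \<le> 10 * (\<kappa> * Q * \<Delta> * s)"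
      using small(1) unfolding s(3) by (simp add: algebra_simps)
    also have "\<dots> = 10 / 48 * (\<delta> * Q * s * \<Delta>\<^sup>2)" by (simp add: \<kappa>_def power2_eq_square)
    also have "\<dots> < 1 / 4 * (\<delta> * Q * s * \<Delta>\<^sup>2)"
      using pos s \<open>Q > 0\<close> by (intro mult_strict_right_mono) auto
    also have "\<dots> = \<delta> * Q / 2 * s * (v - u)\<^sup>2 / 2" by (simp add: uv)
    finally show "2 * \<bar>p u\<bar> + s * \<bar>p v\<bar> < \<delta> * Q / 2 * s * (v - u)\<^sup>2 / 2" .
  qed (use pos \<open>Q > 0\<close> in auto)
  moreover have "s * \<bar>v - u\<bar> < k / 2" using uv s k by simp
  ultimately show ?thesis by force
qed

text \<open>The condition on \<open>a 1\<close> bounds the slope of the chord of P between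
  \<open>x\<close> and \<open>y\<close>, the one on \<open>a 0\<close> bounds P(x). As P(y) is P(x)
  plus slope times \<open>y - x\<close>, both values are small and \<open>root_near\<close> applies
  twice. Since \<open>k \<le> l\<close>, the tolerance at \<open>x\<close> is also affordable at
  \<open>y\<close>.\<close>

lemma admissible_coefficients:
  fixes a :: "nat \<Rightarrow> int" and Q k l :: real
  assumes a: "\<And>j. 2 \<le> j \<Longrightarrow> j \<le> n \<Longrightarrow> lam j * Q < a j \<and> a j \<le> 2 * lam j * Q" and Q: "Q > 0"
    and k: "0 < k" "k \<le> l" "l \<le> 2 * \<Delta>"
    and a1: "\<bar>a 1 + (W a y - W a x) / (y - x)\<bar> \<le> \<delta> * Q * l / 96"
    and a0: "\<bar>a 0 + a 1 * x + W a x\<bar> \<le> \<kappa> * Q * k / 2"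
  shows "j \<le> n \<Longrightarrow> \<bar>a j\<bar> \<le> Q"
    "\<exists>u v. \<bar>u - x\<bar> < k / 2 \<and> \<bar>v - y\<bar> < l / 2 \<and>
       (\<Sum>j\<le>n. real_of_int (a j) * u ^ j) = 0 \<and> (\<Sum>j\<le>n. real_of_int (a j) * v ^ j) = 0"
proof -
  have big: "\<bar>a j\<bar> \<le> 2 * \<delta> * Q" if "2 \<le> j" "j \<le> n" for j
  proof -
    have "0 < lam j * Q" "lam j * Q \<le> \<delta> * Q" using pos Q lam_le by auto
    then show ?thesis using a[OF that] by auto
  qed
  \<comment> \<open>\<open>E\<close> is made for this bound: fewer than \<open>n\<close> terms, each
    at most \<open>2 * \<delta> * Q * R ^ n\<close>.\<close>
  have W: "\<bar>W a t\<bar> \<le> E * \<delta> * Q" if "\<bar>t\<bar> \<le> R" for t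
  proof -
    have "\<bar>W a t\<bar> \<le> (\<Sum>j=2..n. \<bar>real_of_int (a j) * t ^ j\<bar>)" unfolding W_def by (rule sum_abs)
    also have "\<dots> \<le> (\<Sum>j=2..n. 2 * \<delta> * Q * R ^ n)"
    proof (intro sum_mono)
      fix j assume j: "j \<in> {2..n}"
      have "\<bar>t\<bar> ^ j \<le> R ^ j" using that by (intro power_mono) auto
      also have "\<dots> \<le> R ^ n" using j pos by (intro power_increasing) auto
      finally show "\<bar>real_of_int (a j) * t ^ j\<bar> \<le> 2 * \<delta> * Q * R ^ n"
        unfolding abs_mult using j big[of j] pos Q by (intro mult_mono) (auto simp: power_abs)
    qed
    also have "\<dots> = real (n - 1) * (2 * \<delta> * Q * R ^ n)" by simp
    also have "\<dots> \<le> real n * (2 * \<delta> * Q * R ^ n)" using pos Q by (intro mult_right_mono) auto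
    also have "\<dots> = E * \<delta> * Q" by (simp add: E_def)
    finally show ?thesis .
  qed
  have xR: "\<bar>x\<bar> \<le> R" "\<bar>y\<bar> \<le> R" by (auto simp: R_def)
  have kl: "\<delta> * Q * l / 96 \<le> \<delta> * Q * \<Delta>" "\<kappa> * Q * k / 2 \<le> \<delta> * Q * \<Delta>\<^sup>2"
  proof -
    have "\<delta> * Q * l \<le> \<delta> * Q * (2 * \<Delta>)" using k pos Q by (intro mult_left_mono) auto
    moreover have "\<delta> * Q * \<Delta> \<ge> 0" using pos Q by auto
    ultimately show "\<delta> * Q * l / 96 \<le> \<delta> * Q * \<Delta>" by simp
    have "\<kappa> * Q * k \<le> \<kappa> * Q * (2 * \<Delta>)" using k pos Q by (intro mult_left_mono) auto
    moreover have "\<delta> * Q * \<Delta>\<^sup>2 \<ge> 0" using pos Q by auto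
    ultimately show "\<kappa> * Q * k / 2 \<le> \<delta> * Q * \<Delta>\<^sup>2"
      by (simp add: \<kappa>_def power2_eq_square algebra_simps)
  qed
  have "\<bar>(W a y - W a x) / (y - x)\<bar> \<le> 2 * (E * \<delta> * Q) / \<Delta>"
    unfolding abs_divide \<Delta>_def[symmetric] using W[OF xR(1)] W[OF xR(2)] pos
    by (intro divide_right_mono) auto
  then have "\<bar>a 1\<bar> \<le> 2 * (E * \<delta> * Q) / \<Delta> + \<delta> * Q * \<Delta>"
    using a1 kl by linarith
  also have "\<dots> = (\<delta> * (2 * E / \<Delta> + \<Delta>)) * Q" by (simp add: algebra_simps)
  finally have A1: "\<bar>a 1\<bar> \<le> (\<delta> * (2 * E / \<Delta> + \<Delta>)) * Q" by simp
  have "\<bar>a 1 * x\<bar> \<le> ((\<delta> * (2 * E / \<Delta> + \<Delta>)) * Q) * R"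
    unfolding abs_mult using A1 xR pos by (intro mult_mono) auto
  then have "\<bar>a 0\<bar> \<le> \<delta> * Q * \<Delta>\<^sup>2 + ((\<delta> * (2 * E / \<Delta> + \<Delta>)) * Q) * R + E * \<delta> * Q"
    using a0 kl W[OF xR(1)] by linarith
  also have "\<dots> = (\<delta> * (\<Delta>\<^sup>2 + R * (2 * E / \<Delta> + \<Delta>) + E)) * Q" by (simp add: algebra_simps)
  finally have A0: "\<bar>a 0\<bar> \<le> (\<delta> * (\<Delta>\<^sup>2 + R * (2 * E / \<Delta> + \<Delta>) + E)) * Q" by simp
  have scale: "t * Q \<le> Q" if "t \<le> 1" for t :: real using mult_right_mono[OF that, of Q] Q by simp
  show "\<bar>a j\<bar> \<le> Q" if "j \<le> n"
  proof -
    consider "j = 0" | "j = 1" | "2 \<le> j" by linarith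
    then show ?thesis
    proof cases
      case 3
      then have "\<bar>a j\<bar> \<le> (\<delta> * 2) * Q" using big that by (simp add: mult.commute)
      then show ?thesis using scale[OF \<delta>_bounds(1)] by linarith
    qed (use A0 A1 scale[OF \<delta>_bounds(2)] scale[OF \<delta>_bounds(3)] in auto)
  qed
  define p where "p t = (\<Sum>j\<le>n. real_of_int (a j) * t ^ j)" for t
  have px: "\<bar>p x\<bar> \<le> \<kappa> * Q * k / 2" using a0 by (simp add: p_def sum_split)
  \<comment> \<open>As 96 is twice the 48 in \<open>\<kappa>\<close>, P(x) and the slope term each
    contribute at most \<open>\<kappa> * Q * l / 2\<close>.\<close>
  have "p y = p x + (a 1 + (W a y - W a x) / (y - x)) * (y - x)"
    using xy by (simp add: p_def sum_split field_simps)
  moreover have "\<bar>(a 1 + (W a y - W a x) / (y - x)) * (y - x)\<bar> \<le> \<delta> * Q * l / 96 * \<Delta>"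
    unfolding abs_mult \<Delta>_def[symmetric] using a1 pos by (intro mult_right_mono) auto
  moreover have "\<delta> * Q * l / 96 * \<Delta> = \<kappa> * Q * l / 2" by (simp add: \<kappa>_def)
  moreover have "\<kappa> * Q * k \<le> \<kappa> * Q * l" using k pos Q by (intro mult_left_mono) auto
  ultimately have py: "\<bar>p y\<bar> \<le> \<kappa> * Q * l" using px by linarith
  have "0 \<le> \<kappa> * Q * k" using k pos Q by simp
  then have px': "\<bar>p x\<bar> \<le> \<kappa> * Q * k" using px by linarith
  have "\<exists>z. \<bar>z - x\<bar> < k / 2 \<and> p z = 0"
    unfolding p_def by (rule root_near[OF a Q, of _ y _ l]) (use k px' py in \<open>auto simp: p_def\<close>)
  moreover have "\<exists>z. \<bar>z - y\<bar> < l / 2 \<and> p z = 0"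
    unfolding p_def by (rule root_near[OF a Q, of _ x _ k]) (use k px' py in \<open>auto simp: p_def\<close>)
  ultimately show "\<exists>u v. \<bar>u - x\<bar> < k / 2 \<and> \<bar>v - y\<bar> < l / 2 \<and>
       (\<Sum>j\<le>n. real_of_int (a j) * u ^ j) = 0 \<and> (\<Sum>j\<le>n. real_of_int (a j) * v ^ j) = 0"
    unfolding p_def by blast
qed

text \<open>The coefficients are fixed modulo \<open>M\<close>: the factor 4 serves Eisenstein's criterion, while
  \<open>a\<^sub>n \<equiv> 1\<close> modulo \<open>32!\<close> excludes common divisors up to 32, so that the crude sieve bound
  \<open>\<Sum>\<^sub>c\<^sub>>\<^sub>3\<^sub>2 1/c\<^sup>2 \<le> 1/32\<close> suffices.\<close>

definition M :: int where "M = 4 * fact 32"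

lemma M: "M > 0" "4 dvd M" "1 < c \<Longrightarrow> c \<le> 32 \<Longrightarrow> c dvd M"
proof -
  show "M > 0" "4 dvd M" by (simp_all add: M_def)
  assume c: "1 < c" "c \<le> 32"
  then have "nat c dvd (fact 32 :: nat)" by (intro dvd_fact) auto
  then have "int (nat c) dvd int (fact 32)" by (simp only: int_dvd_int_iff)
  then have "c dvd fact 32" using c by simp
  then show "c dvd M" by (simp add: M_def)
qed

section \<open>Thresholds and the number of admissible polynomials\<close>

definition "m = real_of_int M"
text \<open>The first summand makes the window of \<open>a 1\<close> long enough for the sieve, with
  4608 = 48 * 96; the second makes the window of \<open>a 0\<close> at least \<open>2 * m\<close>
  long.\<close>

definition "c\<^sub>0 = (4608 * m / \<delta>)\<^sup>2 * lam n + 4 * m * \<Delta> / \<kappa>"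
definition "q\<^sub>0 = (96 * m)\<^sup>2 / \<delta>'"
text \<open>A product of guaranteed densities: the \<open>n - 2\<close> middle coefficients, the
  coprime pair (384 = 8 * 48), and the constant coefficient.\<close>

definition "c\<^sub>2 = (\<delta>' / (2 * m)) ^ (n - 2) * (\<delta>' * \<delta> / (384 * m\<^sup>2) * (\<kappa> / (2 * m)))"

lemma m1: "m \<ge> 1"
  using M(1) unfolding m_def by linarith

lemma consts_pos: "c\<^sub>0 > 0" "q\<^sub>0 > 0" "c\<^sub>2 > 0"
proof -
  have "m > 0" using m1 by simp
  then show "c\<^sub>0 > 0" "q\<^sub>0 > 0" "c\<^sub>2 > 0"
    unfolding c\<^sub>0_def q\<^sub>0_def c\<^sub>2_def using pos
    by (auto intro!: add_nonneg_pos mult_pos_pos divide_pos_pos zero_less_power intro: less_imp_le)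
qed

text \<open>Only \<open>k * l * Q\<close> is bounded below. As \<open>l\<close> is the longer side,
  \<open>l^2 * Q\<close> is bounded below too, so the window of \<open>a 1\<close> has length of
  order at least \<open>sqrt Q\<close>, just what the sieve tolerates. As
  \<open>l \<le> 2 * \<Delta>\<close>, also \<open>k * Q\<close> is bounded below.\<close>

lemma size_bounds:
  assumes Q: "Q > q\<^sub>0" and k: "0 < k" "k \<le> l" "l \<le> 2 * \<Delta>" and kl: "k * l * Q > c\<^sub>0"
  shows "lam j * Q \<ge> (96 * m)\<^sup>2" "lam j * Q \<ge> 2 * m" "\<delta> * Q * l / 48 \<ge> 96 * m * sqrt (lam n * Q)"
    "\<kappa> * Q * k \<ge> 2 * m"
proof -
  have Q0: "Q > 0" using Q consts_pos by linarith
  have "(96 * m)\<^sup>2 < \<delta>' * Q" using Q pos(5) by (simp add: q\<^sub>0_def divide_less_eq mult.commute)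
  also have "\<dots> \<le> lam j * Q" using lam_le Q0 by (intro mult_right_mono) auto
  finally show 1: "lam j * Q \<ge> (96 * m)\<^sup>2" by simp
  have "m * 1 \<le> m * m" using m1 by (intro mult_left_mono) auto
  then show "lam j * Q \<ge> 2 * m" using 1 m1 unfolding power2_eq_square by linarith
  have pieces: "(4608 * m / \<delta>)\<^sup>2 * lam n \<ge> 0" "4 * m * \<Delta> / \<kappa> \<ge> 0" using pos m1 less_imp_le[OF pos(7)] by auto
  have "k * l * Q \<le> l * l * Q" using k Q0 by (intro mult_right_mono) auto
  then have "(4608 * m / \<delta>)\<^sup>2 * lam n \<le> l * l * Q" using kl pieces unfolding c\<^sub>0_def by linarith
  then have "(4608 * m / \<delta>)\<^sup>2 * lam n * Q \<le> l * l * Q * Q" using Q0 by (intro mult_right_mono) auto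
  then have "sqrt ((4608 * m / \<delta>)\<^sup>2 * (lam n * Q)) \<le> sqrt ((l * Q)\<^sup>2)"
    by (intro real_sqrt_le_mono) (simp add: power2_eq_square mult_ac)
  then have "4608 * m / \<delta> * sqrt (lam n * Q) \<le> l * Q"
    using m1 pos k Q0 by (simp add: real_sqrt_mult)
  then have "\<delta> * (4608 * m / \<delta> * sqrt (lam n * Q)) \<le> \<delta> * (l * Q)" using pos by (intro mult_left_mono) auto
  then have "4608 * m * sqrt (lam n * Q) \<le> \<delta> * Q * l" using pos(4) by (simp add: mult_ac)
  then show "\<delta> * Q * l / 48 \<ge> 96 * m * sqrt (lam n * Q)" by simp
  have "k * l * Q \<le> k * (2 * \<Delta>) * Q" using k Q0 by (intro mult_right_mono mult_left_mono) auto
  then have "4 * m * \<Delta> / \<kappa> \<le> k * (2 * \<Delta>) * Q" using kl pieces unfolding c\<^sub>0_def by linarith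
  then have "4 * m * \<Delta> \<le> k * (2 * \<Delta>) * Q * \<kappa>" using pos(6) by (simp add: divide_le_eq)
  then have "\<Delta> * (2 * m) \<le> \<Delta> * (\<kappa> * Q * k)" by (simp add: mult_ac)
  then show "\<kappa> * Q * k \<ge> 2 * m" using pos(1) by (simp only: mult_le_cancel_left_pos)
qed

text \<open>The longer side governs \<open>a 1\<close>, which enters the sieve; the shorter one
  governs \<open>a 0\<close>, chosen last and subject only to its window and a congruence.\<close>

lemma many_polynomials:
  assumes Q: "Q > q\<^sub>0" and k: "0 < k" "k \<le> l" "l \<le> 2 * \<Delta>" and kl: "k * l * Q > c\<^sub>0"
  shows "\<exists>F. c\<^sub>2 * Q ^ (n + 1) * (k * l) \<le> real (card F) \<and>
    (\<forall>P\<in>F. irreducible P \<and> Polynomial.content P = 1 \<and> lead_coeff P > 0 \<and> degree P \<le> n \<and>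
      of_int (height P) \<le> Q \<and> (\<exists>u v. \<bar>u - x\<bar> < k / 2 \<and> \<bar>v - y\<bar> < l / 2 \<and> vanishes_at P (u, v)))"
proof -
  note sizes = size_bounds[OF Q k kl]
  have Q0: "Q > 0" using Q consts_pos by linarith
  define h where "h = \<delta> * Q * l / 48"
  define A where "A j = {a::int. lam j * Q < a \<and> a \<le> lam j * Q + lam j * Q \<and> [a = 0] (mod M)}" for j
  \<comment> \<open>For \<open>n = 2\<close> there are no middle coefficients and this is a
    singleton.\<close>
  define X where "X = Pi\<^sub>E {2..<n} A"
  \<comment> \<open>Left end of a window of length \<open>h\<close> centred where the chord slope
    vanishes; \<open>h / 2\<close> is the tolerance of
    \<open>admissible_coefficients\<close>.\<close>
  define w where "w f b = - ((W (f(n := b)) y - W (f(n := b)) x) / (y - x)) - h / 2" for f and b :: int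
  define Y where "Y f = {(b, c). b \<in> {b::int. lam n * Q < b \<and> b \<le> lam n * Q + lam n * Q \<and> [b = 1] (mod M)} \<and>
      c \<in> {c::int. w f b < c \<and> c \<le> w f b + h \<and> [c = 0] (mod M)} \<and> coprime b c}" for f
  \<comment> \<open>Likewise centred at the constant coefficient for which P(x) = 0.\<close>
  define z where "z f b c = - (c * x) - W (f(n := b)) x - \<kappa> * Q * k / 2" for f and b c :: int
  define Z where "Z f q = {d::int. z f (fst q) (snd q) < d \<and> d \<le> z f (fst q) (snd q) + \<kappa> * Q * k \<and>
      [d = 2] (mod M)}" for f q
  define F where "F = {coeff_poly n (f(n := b, 1 := c, 0 := d)) | f b c d.
      f \<in> X \<and> (b, c) \<in> Y f \<and> d \<in> Z f (b, c)}"
  have half: "t / (2 * m) \<le> t / m - 1" if "t \<ge> 2 * m" for t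
    using that m1 by (simp add: field_simps)
  note residue = card_residue_class_ge[OF M(1), folded m_def]
  have finA: "finite (A j)" for j unfolding A_def by (rule residue)
  have cardA: "\<delta>' * Q / (2 * m) \<le> card (A j)" for j
  proof -
    have "\<delta>' * Q / (2 * m) \<le> lam j * Q / (2 * m)"
      using lam_le(1)[of j] Q0 m1 by (intro divide_right_mono mult_right_mono) auto
    also have "\<dots> \<le> lam j * Q / m - 1" by (rule half[OF sizes(2)])
    also have "\<dots> \<le> card (A j)" unfolding A_def by (rule residue)
    finally show ?thesis .
  qed
  have "(\<delta>' * Q / (2 * m)) ^ (n - 2) = (\<Prod>j\<in>{2..<n}. \<delta>' * Q / (2 * m))" by simp
  also have "\<dots> \<le> (\<Prod>j\<in>{2..<n}. real (card (A j)))"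
    using cardA pos(5) Q0 m1 by (intro prod_mono) auto
  also have "\<dots> = card X" unfolding X_def by (simp add: card_PiE)
  finally have cardX: "(\<delta>' * Q / (2 * m)) ^ (n - 2) \<le> card X" .
  have finX: "finite X" unfolding X_def using finA by (intro finite_PiE) auto
  have finY: "finite (Y f)" for f
  proof (rule finite_subset)
    show "Y f \<subseteq> (SIGMA b:{b::int. lam n * Q < b \<and> b \<le> lam n * Q + lam n * Q \<and> [b = 1] (mod M)}.
        {c::int. w f b < c \<and> c \<le> w f b + h \<and> [c = 0] (mod M)})" unfolding Y_def by blast
    show "finite \<dots>" by (intro finite_SigmaI residue)
  qed
  have cardY: "lam n * Q * h / (8 * m\<^sup>2) \<le> card (Y f)" for f
    unfolding Y_def m_def
  proof (rule card_coprime_pairs_ge[OF M(1) M(3)])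
    show "96 * real_of_int M \<le> sqrt (lam n * Q)"
      using sizes(1)[of n] unfolding m_def[symmetric] by (intro real_le_rsqrt)
  qed (use pos Q0 sizes(3) in \<open>auto simp: h_def m_def\<close>)
  have finZ: "finite (Z f q)" for f q unfolding Z_def by (rule residue)
  have cardZ: "\<kappa> * Q * k / (2 * m) \<le> card (Z f q)" for f q
    unfolding Z_def by (rule order_trans[OF half[OF sizes(4)] residue(2)])
  have "card X * (lam n * Q * h / (8 * m\<^sup>2) * (\<kappa> * Q * k / (2 * m))) \<le> card F"
    unfolding F_def
  proof (rule card_coeff_poly_family_ge[OF n2 _ finX])
    show "X \<subseteq> extensional {2..<n}" unfolding X_def PiE_def by blast
    show "0 \<le> \<kappa> * Q * k / (2 * m)" using pos(6) Q0 k m1 by simp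
  qed (use finY cardY finZ cardZ in auto)
  moreover have "c\<^sub>2 * Q ^ (n + 1) * (k * l) \<le> card X * (lam n * Q * h / (8 * m\<^sup>2) * (\<kappa> * Q * k / (2 * m)))"
  proof -
    \<comment> \<open>One power of \<open>Q\<close> comes from each middle coefficient, three from
      \<open>a n\<close>, \<open>a 1\<close> and \<open>a 0\<close>.\<close>
    have "n + 1 = (n - 2) + 3" using n2 by simp
    then have Qn: "Q ^ (n + 1) = Q ^ (n - 2) * (Q * Q * Q)" by (simp only: power_add power3_eq_cube)
    have "c\<^sub>2 * Q ^ (n + 1) * (k * l) = (\<delta>' * Q / (2 * m)) ^ (n - 2) *
        (\<delta>' * Q * h / (8 * m\<^sup>2) * (\<kappa> * Q * k / (2 * m)))"
      unfolding Qn c\<^sub>2_def h_def by (simp add: power_mult_distrib power_divide)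
    also have "\<dots> \<le> card X * (lam n * Q * h / (8 * m\<^sup>2) * (\<kappa> * Q * k / (2 * m)))"
      using cardX pos Q0 k m1 lam_le(1)[of n]
      by (intro mult_mono mult_right_mono divide_right_mono) (auto simp: h_def)
    finally show ?thesis .
  qed
  ultimately have "c\<^sub>2 * Q ^ (n + 1) * (k * l) \<le> card F" by linarith
  moreover have "irreducible P \<and> Polynomial.content P = 1 \<and> lead_coeff P > 0 \<and> degree P \<le> n \<and>
      of_int (height P) \<le> Q \<and> (\<exists>u v. \<bar>u - x\<bar> < k / 2 \<and> \<bar>v - y\<bar> < l / 2 \<and> vanishes_at P (u, v))"
    if PF: "P \<in> F" for P
  proof -
    obtain f b c d where P: "P = coeff_poly n (f(n := b, 1 := c, 0 := d))"
      and f: "f \<in> X" and bc: "(b, c) \<in> Y f" and d: "d \<in> Z f (b, c)"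
      using PF unfolding F_def by blast
    define a where "a = f(n := b, 1 := c, 0 := d)"
    have P: "P = coeff_poly n a" by (simp add: P a_def)
    have a01: "a 0 = d" "a 1 = c" "a n = b" using n2 by (auto simp: a_def)
    \<comment> \<open>\<open>W\<close> starts at index 2, so the updates at 1 and 0 do not affect
      it.\<close>
    have Wa: "W (f(n := b)) t = W a t" for t unfolding W_def a_def by (intro sum.cong) auto
    have fj: "f j \<in> A j" if "2 \<le> j" "j < n" for j using f that unfolding X_def by auto
    have aj: "lam j * Q < a j \<and> a j \<le> 2 * lam j * Q" if "2 \<le> j" "j \<le> n" for j
    proof (cases "j = n")
      case True
      then show ?thesis using bc a01 by (auto simp: Y_def mult_ac)
    next
      case False
      then show ?thesis using fj[of j] that by (auto simp: A_def a_def mult_ac)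
    qed
    have "w f b < c" "c \<le> w f b + h" using bc by (auto simp: Y_def)
    then have a1: "\<bar>a 1 + (W a y - W a x) / (y - x)\<bar> \<le> \<delta> * Q * l / 96"
      unfolding w_def Wa a01 abs_le_iff h_def by linarith
    have "z f b c < d" "d \<le> z f b c + \<kappa> * Q * k" using d by (auto simp: Z_def)
    then have a0: "\<bar>a 0 + a 1 * x + W a x\<bar> \<le> \<kappa> * Q * k / 2"
      unfolding z_def Wa a01 abs_le_iff by linarith
    note adm = admissible_coefficients[OF aj Q0 k a1 a0]
    have "[a j = 0] (mod M)" if "0 < j" "j < n" for j
    proof (cases "j = 1")
      case True
      then show ?thesis using bc a01 by (auto simp: Y_def)
    next
      case False
      then show ?thesis using fj[of j] that by (auto simp: A_def a_def)
    qed
    moreover have "[a n = 1] (mod M)" "coprime (a n) (a 1)" "[a 0 = 2] (mod M)"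
      using bc d a01 by (auto simp: Y_def Z_def)
    ultimately have irr: "irreducible P" "Polynomial.content P = 1"
      unfolding P using coeff_poly_irreducible[OF n2 M(2)] by blast+
    have "a n > 0"
    proof -
      have "0 < lam n * Q" using pos Q0 by simp
      then show ?thesis using aj[of n] n2 by linarith
    qed
    then have deg: "degree P = n" unfolding P by (intro degree_coeff_poly) auto
    have "height P \<le> \<lfloor>Q\<rfloor>"
      unfolding height_def deg by (rule Max.boundedI) (use adm(1) in \<open>auto simp: P coeff_coeff_poly le_floor_iff\<close>)
    then have "of_int (height P) \<le> Q" by linarith
    moreover have "lead_coeff P > 0" using \<open>a n > 0\<close> unfolding deg by (simp add: P coeff_coeff_poly)
    moreover have "\<exists>u v. \<bar>u - x\<bar> < k / 2 \<and> \<bar>v - y\<bar> < l / 2 \<and> vanishes_at P (u, v)"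
      using adm(2) unfolding vanishes_at_def P by (simp add: eval_coeff_poly)
    ultimately show ?thesis using irr deg by simp
  qed
  ultimately show ?thesis by blast
qed

end

section \<open>Counting in rectangles\<close>

text \<open>The polynomial count assumes that the first side is not the longer one. Interpreting the
  locale for both orders of the points covers either case, at the cost of a maximum or minimum of
  the constants.\<close>

lemma card_algebraic_points_rectangle_ge:
  fixes x y :: real
  assumes n: "n \<ge> 2" and xy: "x \<noteq> y"
  shows "\<exists>c\<^sub>0>0. \<exists>c\<^sub>2>0. \<exists>q\<^sub>0>0. \<forall>Q k l I J. Q > q\<^sub>0 \<longrightarrow> 0 < k \<longrightarrow> 0 < l \<longrightarrow>
    k \<le> 2 * \<bar>y - x\<bar> \<longrightarrow> l \<le> 2 * \<bar>y - x\<bar> \<longrightarrow> interval_about x k I \<longrightarrow> interval_about y l J \<longrightarrow>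
    k * l * Q > c\<^sub>0 \<longrightarrow> c\<^sub>2 * Q ^ (n + 1) * (k * l) \<le> card (algebraic_points_in n Q (I \<times> J))"
proof -
  interpret a: two_points n x y by unfold_locales (use assms in auto)
  interpret b: two_points n y x by unfold_locales (use assms in auto)
  define c\<^sub>0 where "c\<^sub>0 = max a.c\<^sub>0 b.c\<^sub>0"
  define c\<^sub>2 where "c\<^sub>2 = min a.c\<^sub>2 b.c\<^sub>2"
  define q\<^sub>0 where "q\<^sub>0 = max a.q\<^sub>0 b.q\<^sub>0"
  have "c\<^sub>2 * Q ^ (n + 1) * (k * l) \<le> card (algebraic_points_in n Q (I \<times> J))"
    if Q: "Q > q\<^sub>0" and kl: "0 < k" "0 < l" "k \<le> 2 * \<bar>y - x\<bar>" "l \<le> 2 * \<bar>y - x\<bar>"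
      and I: "interval_about x k I" and J: "interval_about y l J" and big: "k * l * Q > c\<^sub>0" for Q k l I J
  proof -
    have sub: "{x - k / 2<..<x + k / 2} \<subseteq> I" "{y - l / 2<..<y + l / 2} \<subseteq> J"
      using interval_about_props I J kl by auto
    have QQ: "Q > 0" "a.q\<^sub>0 < Q" "b.q\<^sub>0 < Q" using Q a.consts_pos by (auto simp: q\<^sub>0_def)
    have cc: "a.c\<^sub>0 < k * l * Q" "b.c\<^sub>0 < l * k * Q" using big by (auto simp: c\<^sub>0_def mult.commute)
    obtain c F where c: "c\<^sub>2 \<le> c" "c * Q ^ (n + 1) * (k * l) \<le> card F"
      and F: "\<And>P. P \<in> F \<Longrightarrow> irreducible P \<and> Polynomial.content P = 1 \<and> lead_coeff P > 0 \<and>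
        degree P \<le> n \<and> of_int (height P) \<le> Q \<and>
        (\<exists>u v. \<bar>u - x\<bar> < k / 2 \<and> \<bar>v - y\<bar> < l / 2 \<and> vanishes_at P (u, v))"
    proof (cases "k \<le> l")
      case True
      then show ?thesis
        using a.many_polynomials[OF QQ(2), of k l] kl cc that[of a.c\<^sub>2]
        by (auto simp: a.\<Delta>_def c\<^sub>2_def)
    next
      case False
      obtain F where F: "b.c\<^sub>2 * Q ^ (n + 1) * (l * k) \<le> real (card F)"
        "\<forall>P\<in>F. irreducible P \<and> Polynomial.content P = 1 \<and> lead_coeff P > 0 \<and>
        degree P \<le> n \<and> of_int (height P) \<le> Q \<and>
        (\<exists>u v. \<bar>u - y\<bar> < l / 2 \<and> \<bar>v - x\<bar> < k / 2 \<and> vanishes_at P (u, v))"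
        using b.many_polynomials[OF QQ(3), of l k] False kl cc
        by (auto simp: b.\<Delta>_def abs_minus_commute)
      show ?thesis
      proof (rule that[of b.c\<^sub>2 F])
        show "c\<^sub>2 \<le> b.c\<^sub>2" by (simp add: c\<^sub>2_def)
        show "b.c\<^sub>2 * Q ^ (n + 1) * (k * l) \<le> real (card F)" using F(1) by (simp add: mult.commute)
        have swap: "vanishes_at P (u, v) \<longleftrightarrow> vanishes_at P (v, u)" for P u v
          by (auto simp: vanishes_at_def)
        show "irreducible P \<and> Polynomial.content P = 1 \<and> lead_coeff P > 0 \<and>
          degree P \<le> n \<and> of_int (height P) \<le> Q \<and>
          (\<exists>u v. \<bar>u - x\<bar> < k / 2 \<and> \<bar>v - y\<bar> < l / 2 \<and> vanishes_at P (u, v))" if "P \<in> F" for P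
          using F(2) that swap by blast
      qed
    qed
    have "c\<^sub>2 * Q ^ (n + 1) * (k * l) \<le> c * Q ^ (n + 1) * (k * l)"
      using c QQ(1) kl by (intro mult_right_mono) auto
    also have "\<dots> \<le> card F" by (rule c)
    also have "\<dots> \<le> card (algebraic_points_in n Q (I \<times> J))"
    proof (intro of_nat_mono card_algebraic_points_in_ge)
      fix P assume "P \<in> F"
      then obtain u v where uv: "\<bar>u - x\<bar> < k / 2" "\<bar>v - y\<bar> < l / 2" "vanishes_at P (u, v)" using F by blast
      then have "u \<in> {x - k / 2<..<x + k / 2}" "v \<in> {y - l / 2<..<y + l / 2}"
        unfolding greaterThanLessThan_iff by linarith+
      then have "(u, v) \<in> I \<times> J" using sub by blast
      then show "irreducible P \<and> Polynomial.content P = 1 \<and> lead_coeff P > 0 \<and>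
        degree P \<le> n \<and> of_int (height P) \<le> Q \<and> (\<exists>\<alpha>\<in>I \<times> J. vanishes_at P \<alpha>)"
        using F[OF \<open>P \<in> F\<close>] uv(3) by blast
    qed
    finally show ?thesis .
  qed
  moreover have "c\<^sub>0 > 0" "c\<^sub>2 > 0" "q\<^sub>0 > 0"
    using a.consts_pos b.consts_pos by (auto simp: c\<^sub>0_def c\<^sub>2_def q\<^sub>0_def)
  ultimately show ?thesis by blast
qed

text \<open>If a half-length exceeded the distance of the midpoints, one interval would contain the
  midpoint of the other, and the rectangle would meet the diagonal.\<close>

lemma separated_rectangle_bounds:
  fixes x y k l :: real
  assumes I: "interval_about x k I" "0 < k" and J: "interval_about y l J" "0 < l" and "\<epsilon> > 0"
    and disj: "(I \<times> J) \<inter> {(x\<^sub>1, x\<^sub>2). \<bar>x\<^sub>1 - x\<^sub>2\<bar> < \<epsilon>} = {}"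
  shows "x \<noteq> y" "k \<le> 2 * \<bar>y - x\<bar>" "l \<le> 2 * \<bar>y - x\<bar>"
proof -
  note sub = interval_about_props(1)[OF I] interval_about_props(1)[OF J]
  have no: False if "t \<in> I" "t \<in> J" for t
  proof -
    have "(t, t) \<in> (I \<times> J) \<inter> {(x\<^sub>1, x\<^sub>2). \<bar>x\<^sub>1 - x\<^sub>2\<bar> < \<epsilon>}" using that \<open>\<epsilon> > 0\<close> by simp
    then show False using disj by blast
  qed
  have mid: "x \<in> I" "y \<in> J" using sub I(2) J(2) by auto
  then show "x \<noteq> y" using no by blast
  show "k \<le> 2 * \<bar>y - x\<bar>"
  proof (rule ccontr)
    assume "\<not> k \<le> 2 * \<bar>y - x\<bar>"
    then have "\<bar>y - x\<bar> < k / 2" by simp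
    then have "y \<in> {x - k / 2<..<x + k / 2}" unfolding greaterThanLessThan_iff abs_less_iff by linarith
    then show False using sub mid no by blast
  qed
  show "l \<le> 2 * \<bar>y - x\<bar>"
  proof (rule ccontr)
    assume "\<not> l \<le> 2 * \<bar>y - x\<bar>"
    then have "\<bar>y - x\<bar> < l / 2" by simp
    then have "x \<in> {y - l / 2<..<y + l / 2}" unfolding greaterThanLessThan_iff abs_less_iff by linarith
    then show False using sub mid no by blast
  qed
qed

text \<open>With side lengths \<open>k\<close>, \<open>l\<close>, the product
  \<open>k * l * Q\<close> is the product of the side constants times \<open>Q\<close> to the power
  1 minus the sum of the exponents. If that power is 0, the bound by \<open>c\<^sub>0\<close> is the
  second condition itself; otherwise it holds from a threshold depending on the side constants,
  hence \<open>Q\<^sub>0\<close> is a function of them.\<close>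

theorem theorem1:
  fixes n :: nat and \<epsilon> :: real and d :: "real \<times> real"
  assumes "n \<ge> 2" and "\<epsilon> > 0"
  shows "\<exists>c\<^sub>0>0::real. \<exists>c\<^sub>2>0::real. \<forall>s\<^sub>1 s\<^sub>2 :: real.
    s\<^sub>1 < 1 \<longrightarrow> s\<^sub>2 < 1 \<longrightarrow> 0 < s\<^sub>1 + s\<^sub>2 \<longrightarrow> s\<^sub>1 + s\<^sub>2 \<le> 1 \<longrightarrow>
    (\<exists>Q\<^sub>0 :: real \<Rightarrow> real \<Rightarrow> real.
      (\<forall>a b. Q\<^sub>0 a b > 0) \<and>
      (s\<^sub>1 + s\<^sub>2 = 1 \<longrightarrow> (\<exists>q. \<forall>a b. Q\<^sub>0 a b = q)) \<and>
      (\<forall>c\<^sub>1\<^sub>1>0. \<forall>c\<^sub>1\<^sub>2>0. \<forall>Q > Q\<^sub>0 c\<^sub>1\<^sub>1 c\<^sub>1\<^sub>2. \<forall>I\<^sub>1 I\<^sub>2.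
         interval_about (fst d) (c\<^sub>1\<^sub>1 * Q powr (- s\<^sub>1)) I\<^sub>1 \<longrightarrow>
         interval_about (snd d) (c\<^sub>1\<^sub>2 * Q powr (- s\<^sub>2)) I\<^sub>2 \<longrightarrow>
         (I\<^sub>1 \<times> I\<^sub>2) \<inter> {(x\<^sub>1, x\<^sub>2). \<bar>x\<^sub>1 - x\<^sub>2\<bar> < \<epsilon>} = {} \<longrightarrow>
         (s\<^sub>1 + s\<^sub>2 = 1 \<longrightarrow> c\<^sub>1\<^sub>1 * c\<^sub>1\<^sub>2 > c\<^sub>0) \<longrightarrow>
         real (card (algebraic_points_in n Q (I\<^sub>1 \<times> I\<^sub>2)))
           \<ge> c\<^sub>2 * Q ^ (n + 1) * measure lborel (I\<^sub>1 \<times> I\<^sub>2)))"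
proof -
  define x y where "x = fst d" and "y = snd d"
  obtain c\<^sub>0 c\<^sub>2 q\<^sub>0 :: real where c: "c\<^sub>0 > 0" "c\<^sub>2 > 0" "q\<^sub>0 > 0"
    and main: "x \<noteq> y \<longrightarrow> (\<forall>Q k l I J. Q > q\<^sub>0 \<longrightarrow> 0 < k \<longrightarrow> 0 < l \<longrightarrow>
      k \<le> 2 * \<bar>y - x\<bar> \<longrightarrow> l \<le> 2 * \<bar>y - x\<bar> \<longrightarrow> interval_about x k I \<longrightarrow> interval_about y l J \<longrightarrow>
      k * l * Q > c\<^sub>0 \<longrightarrow> c\<^sub>2 * Q ^ (n + 1) * (k * l) \<le> card (algebraic_points_in n Q (I \<times> J)))"
  proof (cases "x = y")
    case True
    \<comment> \<open>Equal coordinates are excluded by the separation, so arbitrary positive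
      constants do.\<close>
    then show ?thesis by (intro that[of 1 1 1]) simp_all
  next
    case False
    show ?thesis
      using card_algebraic_points_rectangle_ge[OF assms(1) False]
      by (elim exE conjE) (rule that, assumption+, rule impI)
  qed
  show ?thesis
  proof (rule exI[of _ c\<^sub>0], rule conjI[OF c(1)], rule exI[of _ c\<^sub>2], rule conjI[OF c(2)], intro allI impI)
    fix s\<^sub>1 s\<^sub>2 :: real
    assume s: "s\<^sub>1 + s\<^sub>2 \<le> 1"
    define \<sigma> where "\<sigma> = 1 - s\<^sub>1 - s\<^sub>2"
    \<comment> \<open>The second argument of \<open>max\<close> solves
      \<open>a * b * Q powr \<sigma> = c\<^sub>0\<close> for positive \<open>a\<close>,
      \<open>b\<close>.\<close>
    define Q\<^sub>0 where "Q\<^sub>0 a b = (if \<sigma> = 0 then q\<^sub>0 else max q\<^sub>0 ((c\<^sub>0 / (a * b)) powr (1 / \<sigma>)))" for a b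
    have ge: "Q\<^sub>0 a b \<ge> q\<^sub>0" for a b by (simp add: Q\<^sub>0_def)
    have bound: "c\<^sub>2 * Q ^ (n + 1) * measure lborel (I \<times> J) \<le> real (card (algebraic_points_in n Q (I \<times> J)))"
      if ab: "a > 0" "b > 0" and Q: "Q > Q\<^sub>0 a b" and I: "interval_about x (a * Q powr (- s\<^sub>1)) I"
        and J: "interval_about y (b * Q powr (- s\<^sub>2)) J"
        and disj: "(I \<times> J) \<inter> {(x\<^sub>1, x\<^sub>2). \<bar>x\<^sub>1 - x\<^sub>2\<bar> < \<epsilon>} = {}"
        and prod: "s\<^sub>1 + s\<^sub>2 = 1 \<longrightarrow> a * b > c\<^sub>0" for a b Q I J
    proof -
      have Qq: "Q > q\<^sub>0" using Q ge[of a b] by linarith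
      then have Q0: "Q > 0" using c by linarith
      define k l where "k = a * Q powr (- s\<^sub>1)" and "l = b * Q powr (- s\<^sub>2)"
      note I = I[folded k_def] and J = J[folded l_def]
      have kl: "k > 0" "l > 0" using ab Q0 by (auto simp: k_def l_def)
      have "k * l * Q = a * b * (Q powr (- s\<^sub>1) * Q powr (- s\<^sub>2) * Q powr 1)"
        using Q0 by (simp add: k_def l_def)
      also have "\<dots> = a * b * Q powr \<sigma>"
        unfolding powr_add[symmetric] \<sigma>_def by (simp add: algebra_simps)
      finally have klQ: "k * l * Q = a * b * Q powr \<sigma>" .
      have "c\<^sub>0 < k * l * Q"
      proof (cases "\<sigma> = 0")
        case True
        then show ?thesis using prod Q0 by (simp add: klQ \<sigma>_def)
      next
        case False
        then have \<sigma>: "\<sigma> > 0" using s by (simp add: \<sigma>_def)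
        have "(c\<^sub>0 / (a * b)) powr (1 / \<sigma>) < Q" using Q False by (simp add: Q\<^sub>0_def)
        then have "((c\<^sub>0 / (a * b)) powr (1 / \<sigma>)) powr \<sigma> < Q powr \<sigma>"
          using \<sigma> by (intro powr_less_mono2) auto
        then have "c\<^sub>0 / (a * b) < Q powr \<sigma>" using \<sigma> c ab by (simp add: powr_powr)
        then show ?thesis unfolding klQ using ab by (simp add: divide_less_eq mult_ac)
      qed
      then have "c\<^sub>2 * Q ^ (n + 1) * (k * l) \<le> card (algebraic_points_in n Q (I \<times> J))"
        using separated_rectangle_bounds[OF I kl(1) J kl(2) assms(2) disj]
        by (intro main[rule_format] Qq kl I J)
      then show ?thesis using measure_interval_about_Times[OF I J kl] by simp
    qed
    show "\<exists>Q\<^sub>0 :: real \<Rightarrow> real \<Rightarrow> real.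
      (\<forall>a b. Q\<^sub>0 a b > 0) \<and>
      (s\<^sub>1 + s\<^sub>2 = 1 \<longrightarrow> (\<exists>q. \<forall>a b. Q\<^sub>0 a b = q)) \<and>
      (\<forall>c\<^sub>1\<^sub>1>0. \<forall>c\<^sub>1\<^sub>2>0. \<forall>Q > Q\<^sub>0 c\<^sub>1\<^sub>1 c\<^sub>1\<^sub>2. \<forall>I\<^sub>1 I\<^sub>2.
         interval_about (fst d) (c\<^sub>1\<^sub>1 * Q powr (- s\<^sub>1)) I\<^sub>1 \<longrightarrow>
         interval_about (snd d) (c\<^sub>1\<^sub>2 * Q powr (- s\<^sub>2)) I\<^sub>2 \<longrightarrow>
         (I\<^sub>1 \<times> I\<^sub>2) \<inter> {(x\<^sub>1, x\<^sub>2). \<bar>x\<^sub>1 - x\<^sub>2\<bar> < \<epsilon>} = {} \<longrightarrow>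
         (s\<^sub>1 + s\<^sub>2 = 1 \<longrightarrow> c\<^sub>1\<^sub>1 * c\<^sub>1\<^sub>2 > c\<^sub>0) \<longrightarrow>
         real (card (algebraic_points_in n Q (I\<^sub>1 \<times> I\<^sub>2)))
           \<ge> c\<^sub>2 * Q ^ (n + 1) * measure lborel (I\<^sub>1 \<times> I\<^sub>2))"
    proof (intro exI[of _ Q\<^sub>0] conjI)
      show "\<forall>a b. Q\<^sub>0 a b > 0" using ge c(3) by (meson less_le_trans)
      show "s\<^sub>1 + s\<^sub>2 = 1 \<longrightarrow> (\<exists>q. \<forall>a b. Q\<^sub>0 a b = q)" by (auto simp: Q\<^sub>0_def \<sigma>_def)
    qed (intro allI impI, rule bound[unfolded x_def y_def])
  qed
qed

end
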